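(* Let $\xi\ge1$ be a countable ordinal, $\Sigma=\{\alpha_1,\alpha_2,\dots\}$ an infinite countable alphabet, $\upsilon\notin\Sigma$ a variable and $\vec k=(k_n)_{n\in\mathbb N}\subseteq\mathbb N$ an increasing sequence. For every family $\mathcal F\subseteq L^{<\infty}(\Sigma,\vec k;\upsilon)$ and every $\vec w\in L^\infty(\Sigma,\vec k;\upsilon)$ there exists an extraction $\vec u\prec\vec w$ such that either $L^\xi(\Sigma,\vec k;\upsilon)\cap EV^{<\infty}(\vec u)\subseteq\mathcal F$, or $L^\xi(\Sigma,\vec k;\upsilon)\cap EV^{<\infty}(\vec u)\subseteq L^{<\infty}(\Sigma,\vec k;\upsilon)\setminus\mathcal F$.
   Context: $\mathbb N=\{1,2,\dots\}$. $L(\Sigma,\vec k)$: functions $w$ from a nonempty finite $\mathrm{dom}(w)\subseteq\mathbb N$ into $\Sigma$ with $w(n)\in\{\alpha_1,\dots,\alpha_{k_n}\}$; $L(\Sigma,\vec k;\upsilon)$: functions $w$ from a nonempty finite $\mathrm{dom}(w)\subseteq\mathbb N$ into $\Sigma\cup\{\upsilon\}$ with $w(n)\in\{\upsilon,\alpha_1,\dots,\alpha_{k_n}\}$ and $\upsilon$ attained. $w<u$ iff $\max\mathrm{dom}(w)<\min\mathrm{dom}(u)$, and then $w\star u$ is the word on $\mathrm{dom}(w)\cup\mathrm{dom}(u)$ agreeing with $w,u$. $T_0(w)=w$; for $p\in\mathbb N$, $T_p(w)$ replaces each $\upsilon$ at position $n$ by $\alpha_{\min(p,k_n)}$. $L^\infty(\Sigma,\vec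 k;\upsilon)$: sequences $\vec w=(w_n)$ in $L(\Sigma,\vec k;\upsilon)$ with $w_n<w_{n+1}$. $EV(\vec w)$: all words $T_{p_1}(w_{n_1})\star\cdots\star T_{p_\lambda}(w_{n_\lambda})$, $\lambda\in\mathbb N$, $n_1<\dots<n_\lambda$, integers $0\le p_i\le k_{n_i}$, some $p_i=0$. $\vec u\prec\vec w$ iff $\vec u\in L^\infty(\Sigma,\vec k;\upsilon)$ and all terms of $\vec u$ lie in $EV(\vec w)$. $L^{<\infty}(\Sigma,\vec k;\upsilon)$: the empty sequence $\emptyset$ together with all tuples $(w_1,\dots,w_l)$, $l\in\mathbb N$, $w_1<\dots<w_l$ in $L(\Sigma,\vec k;\upsilon)$. $EV^{<\infty}(\vec w)$: $\emptyset$ and all such tuples with all $w_i\in EV(\vec w)$. Schreier families: for each nonzero countable limit ordinal $\lambda$ fix a strictly increasing sequence $(\lambda_n)$ of successor ordinals $<\lambda$ with $\sup_n\lambda_n=\lambda$. For finite $s_1,s_2\subseteq\mathbb N$ nonempty, $s_1<s_2$ means $\max s_1<\min s_2$. Define $\mathcal A_0=\{\emptyset\}$, $\mathcal A_1=\{\{n\}:n\in\mathbb N\}$; $\mathcal A_{\zeta+1}=\{\{n\}\cup s_1: n\in\mathbb N,\ \{n\}<s_1,\ s_1\in\mathcal A_\zeta\}$; $\mathcal A_{\omega^{\beta+1}}=\{s_1\cup\dots\cup s_n: n=\min s_1,\ s_1<\dots<s_n,\ s_i\in\mathcal A_{\omega^\beta}\}$; for a countable limit $\lambda>0$, $\mathcal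 A_{\omega^\lambda}=\{s\ne\emptyset: s\in\mathcal A_{\omega^{\lambda_n}}\text{ with }n=\min s\}$; for a limit $\xi$ with $\omega^\alpha<\xi<\omega^{\alpha+1}$, $0<\alpha<\omega_1$, written $\xi=\omega^\alpha p+\sum_{i=1}^m\omega^{a_i}p_i$ ($m\ge0$, $p,p_i\ge1$ integers, $\alpha>a_1>\dots>a_m>0$), $\mathcal A_\xi$ is the set of $s=s_0\cup\bigcup_{i=1}^m s_i$ with $s_m<\dots<s_1<s_0$, $s_0=s^0_1\cup\dots\cup s^0_p$ with $s^0_1<\dots<s^0_p\in\mathcal A_{\omega^\alpha}$ and $s_i=s^i_1\cup\dots\cup s^i_{p_i}$ with $s^i_1<\dots<s^i_{p_i}\in\mathcal A_{\omega^{a_i}}$. Then $L^0(\Sigma,\vec k;\upsilon)=\{\emptyset\}$ and for $\xi\ge1$, $L^\xi(\Sigma,\vec k;\upsilon)$ is the set of $(w_1,\dots,w_l)\in L^{<\infty}(\Sigma,\vec k;\upsilon)$ with $\{\min\mathrm{dom}(w_1),\dots,\min\mathrm{dom}(w_l)\}\in\mathcal A_\xi$. *)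

theory Defs
  imports Complex_Main "HOL-Library.Countable_Set"
begin

section \<open>Countable ordinals\<close>

text \<open>The cardinal successor of the order type of the natural numbers is a well-order of type
  \<open>\<omega>\<^sub>1\<close>; its points are the countable ordinals.\<close>

typedef cord = "Field (cardSuc natLeq)"
proof -
  have "infinite (Field (cardSuc natLeq))"
    using cardSuc_finite[OF natLeq_Card_order] by (simp add: Field_natLeq)
  then show ?thesis by (metis ex_in_conv finite.emptyI)
qed

instantiation cord :: linorder
begin

definition less_eq_cord :: "cord \<Rightarrow> cord \<Rightarrow> bool" where
  "x \<le> y \<longleftrightarrow> (Rep_cord x, Rep_cord y) \<in> cardSuc natLeq"

definition less_cord :: "cord \<Rightarrow> cord \<Rightarrow> bool" where
  "(x::cord) < y \<longleftrightarrow> x \<le> y \<and> \<not> y \<le> x"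

lemma cardSuc_natLeq_Well_order: "Well_order (cardSuc natLeq)"
  using cardSuc_Card_order[OF natLeq_Card_order] card_order_on_well_order_on by blast

instance
proof
  have W: "Well_order (cardSuc natLeq)" by (rule cardSuc_natLeq_Well_order)
  then have L: "Linear_order (cardSuc natLeq)" by (simp add: well_order_on_def)
  then have P: "Refl (cardSuc natLeq)" "trans (cardSuc natLeq)" "antisym (cardSuc natLeq)"
    "Total (cardSuc natLeq)"
    by (simp_all add: linear_order_on_def partial_order_on_def preorder_on_def)
  fix x y z :: cord
  show "(x < y) = (x \<le> y \<and> \<not> y \<le> x)" by (rule less_cord_def)
  show xx: "x \<le> x" for x :: cord
    using P(1) Rep_cord[of x] by (auto simp: less_eq_cord_def refl_on_def)
  show "x \<le> y \<Longrightarrow> y \<le> z \<Longrightarrow> x \<le> z"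
    using P(2) by (auto simp: less_eq_cord_def dest: transD)
  show "x \<le> y \<Longrightarrow> y \<le> x \<Longrightarrow> x = y"
    using P(3) by (auto simp: less_eq_cord_def Rep_cord_inject dest: antisymD)
  show "x \<le> y \<or> y \<le> x"
  proof (cases "x = y")
    case False
    then have "Rep_cord x \<noteq> Rep_cord y" by (simp add: Rep_cord_inject)
    then show ?thesis
      using P(4) Rep_cord[of x] Rep_cord[of y] by (auto simp: less_eq_cord_def total_on_def)
  qed (simp add: xx)
qed

end

instance cord :: wellorder
proof
  fix P :: "cord \<Rightarrow> bool" and a :: cord
  assume step: "\<And>x. (\<And>y. y < x \<Longrightarrow> P y) \<Longrightarrow> P x"
  have "wf (cardSuc natLeq - Id)"
    using cardSuc_natLeq_Well_order by (simp add: well_order_on_def)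
  then have "wf (inv_image (cardSuc natLeq - Id) Rep_cord)" by (rule wf_inv_image)
  moreover have "(y, x) \<in> inv_image (cardSuc natLeq - Id) Rep_cord \<longleftrightarrow> y < x" for x y
    unfolding in_inv_image less_le by (simp add: less_eq_cord_def Rep_cord_inject)
  ultimately show "P a"
    by (induction a rule: wf_induct_rule) (use step in blast)
qed

context
  includes cardinal_syntax
begin

lemma countable_atMost_cord: "countable {..x::cord}"
proof -
  let ?r = "cardSuc natLeq"
  have "|underS ?r (Rep_cord x)| <o ?r"
    using card_of_underS[OF cardSuc_Card_order[OF natLeq_Card_order]] Rep_cord by blast
  then have "|underS ?r (Rep_cord x)| \<le>o natLeq"
    using cardSuc_ordLeq_ordLess[OF natLeq_Card_order card_of_Card_order] by blast
  then have "|underS ?r (Rep_cord x)| \<le>o |UNIV :: nat set|"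
    using card_of_nat ordIso_symmetric ordLeq_ordIso_trans by blast
  then have "countable (underS ?r (Rep_cord x))"
    by (metis card_of_ordLeq countableI)
  moreover have "Rep_cord ` {..<x} \<subseteq> underS ?r (Rep_cord x)"
    by (auto simp: underS_def less_le less_eq_cord_def Rep_cord_inject)
  ultimately have "countable {..<x}"
    by (meson Rep_cord_inject countable_image_inj_on countable_subset inj_onI)
  moreover have "{..x} = insert x {..<x}" by auto
  ultimately show ?thesis by simp
qed

lemma uncountable_UNIV_cord: "\<not> countable (UNIV :: cord set)"
proof
  assume "countable (UNIV :: cord set)"
  then have "countable (Field (cardSuc natLeq))"
    by (metis countable_image type_definition.Rep_range type_definition_cord)
  then have "|Field (cardSuc natLeq)| \<le>o |UNIV :: nat set|"
    by (metis card_of_ordLeq countable_def subset_UNIV)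
  then have "cardSuc natLeq \<le>o natLeq"
    using card_of_Field_ordIso[OF cardSuc_Card_order[OF natLeq_Card_order]]
      card_of_nat ordIso_symmetric ordLeq_ordIso_trans ordIso_ordLeq_trans by blast
  then show False
    using cardSuc_greater[OF natLeq_Card_order] not_ordLess_ordLeq by blast
qed

end

lemma cord_countable_strictly_bounded:
  assumes "countable (X :: cord set)"
  shows "\<exists>y. \<forall>x\<in>X. x < y"
proof (rule ccontr)
  assume "\<not> ?thesis"
  then have "UNIV = (\<Union>x\<in>X. {..x})" by (force simp: not_less)
  moreover have "countable (\<Union>x\<in>X. {..x})" using assms countable_atMost_cord by blast
  ultimately show False using uncountable_UNIV_cord by simp
qed

instantiation cord :: conditionally_complete_linorder
begin

definition inf_cord :: "cord \<Rightarrow> cord \<Rightarrow> cord" where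
  "inf_cord = min"

definition sup_cord :: "cord \<Rightarrow> cord \<Rightarrow> cord" where
  "sup_cord = max"

definition Inf_cord :: "cord set \<Rightarrow> cord" where
  "Inf (X::cord set) = (LEAST x. x \<in> X)"

definition Sup_cord :: "cord set \<Rightarrow> cord" where
  "Sup (X::cord set) = (LEAST y. \<forall>x\<in>X. x \<le> y)"

instance
proof
  fix x y z :: cord and X :: "cord set"
  show "inf x y \<le> x" "inf x y \<le> y" "x \<le> sup x y" "y \<le> sup x y"
    "x \<le> y \<Longrightarrow> x \<le> z \<Longrightarrow> x \<le> inf y z" "y \<le> x \<Longrightarrow> z \<le> x \<Longrightarrow> sup y z \<le> x"
    by (simp_all add: inf_cord_def sup_cord_def)
  show "x \<in> X \<Longrightarrow> bdd_below X \<Longrightarrow> Inf X \<le> x"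
    unfolding Inf_cord_def by (rule Least_le)
  show "X \<noteq> {} \<Longrightarrow> (\<And>x. x \<in> X \<Longrightarrow> z \<le> x) \<Longrightarrow> z \<le> Inf X"
    unfolding Inf_cord_def by (metis LeastI_ex ex_in_conv)
  show "x \<in> X \<Longrightarrow> bdd_above X \<Longrightarrow> x \<le> Sup X"
  proof -
    assume "x \<in> X" "bdd_above X"
    then have "\<exists>y. \<forall>x\<in>X. x \<le> y" by (simp add: bdd_above_def)
    then have "\<forall>x\<in>X. x \<le> Sup X" unfolding Sup_cord_def by (rule LeastI_ex)
    with \<open>x \<in> X\<close> show ?thesis by blast
  qed
  show "X \<noteq> {} \<Longrightarrow> (\<And>x. x \<in> X \<Longrightarrow> x \<le> z) \<Longrightarrow> Sup X \<le> z"
    unfolding Sup_cord_def by (simp add: Least_le)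
qed

end

lemma bdd_above_countable_cord: "countable (X :: cord set) \<Longrightarrow> bdd_above X"
  using cord_countable_strictly_bounded by (meson bdd_aboveI less_imp_le)

definition osuc :: "cord \<Rightarrow> cord" where
  "osuc x = (LEAST y. x < y)"

lemma less_osuc: "x < osuc x"
proof -
  have "\<exists>y. x < y" using cord_countable_strictly_bounded[of "{x}"] by simp
  then show ?thesis unfolding osuc_def by (rule LeastI_ex)
qed

lemma osuc_le_iff: "osuc x \<le> y \<longleftrightarrow> x < y"
proof
  show "osuc x \<le> y \<Longrightarrow> x < y" using less_osuc[of x] by (rule order_less_le_trans)
  show "x < y \<Longrightarrow> osuc x \<le> y" unfolding osuc_def by (rule Least_le)
qed

lemma less_osuc_iff: "x < osuc y \<longleftrightarrow> x \<le> y"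
  using osuc_le_iff[of y x] by (meson leD leI order_le_less_trans less_osuc)

lemma osuc_inject: "osuc x = osuc y \<longleftrightarrow> x = y"
  by (metis less_osuc_iff order.antisym order_refl)

instantiation cord :: "{zero, one}"
begin

definition zero_cord :: cord where "0 = (LEAST x::cord. True)"

definition one_cord :: cord where "1 = osuc 0"

instance ..

end

lemma zero_le_cord: "(0::cord) \<le> x"
  by (simp add: zero_cord_def Least_le)

definition is_succ :: "cord \<Rightarrow> bool" where
  "is_succ x \<longleftrightarrow> (\<exists>y. x = osuc y)"

text \<open>Limit ordinals are nonzero by convention.\<close>

definition is_limit :: "cord \<Rightarrow> bool" where
  "is_limit x \<longleftrightarrow> x \<noteq> 0 \<and> \<not> is_succ x"

text \<open>Transfinite iteration of a step function, taking suprema at limits.\<close>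

context
  notes image_cong [fundef_cong]
begin

function orec :: "cord \<Rightarrow> (cord \<Rightarrow> cord) \<Rightarrow> cord \<Rightarrow> cord" where
  "orec z f x =
    (if x = 0 then z
     else if is_succ x then f (orec z f (THE y. x = osuc y))
     else (SUP y\<in>{..<x}. orec z f y))"
  by auto
termination
proof (relation "inv_image {(x, y). x < y} (\<lambda>(_, _, x). x)")
  show "wf (inv_image {(x, y). x < y} (\<lambda>(_ :: cord, _ :: cord \<Rightarrow> cord, x :: cord). x))"
    by (intro wf_inv_image wf)
next
  fix z :: cord and f x
  assume "is_succ x"
  then show "((z, f, THE y. x = osuc y), z, f, x)
      \<in> inv_image {(x, y). x < y} (\<lambda>(_ :: cord, _ :: cord \<Rightarrow> cord, x :: cord). x)"
    by (auto simp: is_succ_def osuc_inject less_osuc)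
qed simp

end

declare orec.simps [simp del]

lemma orec_0: "orec z f 0 = z"
  by (simp add: orec.simps)

lemma orec_osuc: "orec z f (osuc x) = f (orec z f x)"
proof -
  have "osuc x \<noteq> 0" using less_osuc[of x] zero_le_cord[of x] by auto
  then show ?thesis
    by (subst orec.simps) (auto simp: is_succ_def osuc_inject)
qed

lemma orec_limit: "is_limit x \<Longrightarrow> orec z f x = (SUP y\<in>{..<x}. orec z f y)"
  by (subst orec.simps) (simp add: is_limit_def)

instantiation cord :: "{plus, times}"
begin

definition plus_cord :: "cord \<Rightarrow> cord \<Rightarrow> cord" where
  "x + y = orec x osuc y"

definition times_cord :: "cord \<Rightarrow> cord \<Rightarrow> cord" where
  "x * y = orec 0 (\<lambda>z. z + x) y"

instance ..

end

definition oexp :: "cord \<Rightarrow> cord \<Rightarrow> cord" where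
  "oexp x y = orec 1 (\<lambda>z. z * x) y"

lemma plus_cord_rec:
  fixes x y :: cord
  shows "x + 0 = x" and "x + osuc y = osuc (x + y)"
    and "is_limit y \<Longrightarrow> x + y = (SUP z\<in>{..<y}. x + z)"
  unfolding plus_cord_def by (simp_all add: orec_0 orec_osuc orec_limit)

lemma times_cord_rec:
  fixes x y :: cord
  shows "x * 0 = 0" and "x * osuc y = x * y + x"
    and "is_limit y \<Longrightarrow> x * y = (SUP z\<in>{..<y}. x * z)"
  unfolding times_cord_def by (simp_all add: orec_0 orec_osuc orec_limit)

lemma oexp_rec:
  shows "oexp x 0 = 1" and "oexp x (osuc y) = oexp x y * x"
    and "is_limit y \<Longrightarrow> oexp x y = (SUP z\<in>{..<y}. oexp x z)"
  unfolding oexp_def by (simp_all add: orec_0 orec_osuc orec_limit)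

definition ofin :: "nat \<Rightarrow> cord" where
  "ofin n = (osuc ^^ n) 0"

definition oomega :: cord where
  "oomega = (SUP n. ofin n)"

abbreviation omega_exp :: "cord \<Rightarrow> cord" where
  "omega_exp a \<equiv> oexp oomega a"

text \<open>The value \<open>\<omega>\<^bsup>a\<^sub>1\<^esup> p\<^sub>1 + \<dots> + \<omega>\<^bsup>a\<^sub>m\<^esup> p\<^sub>m\<close> of a list of exponent-coefficient pairs.\<close>

definition omega_sum :: "(cord \<times> nat) list \<Rightarrow> cord" where
  "omega_sum cs = foldr (\<lambda>(a, p) x. omega_exp a * ofin p + x) cs 0"


section \<open>Schreier families\<close>

text \<open>From here on, \<open>\<nat>\<close> means \<open>{1..}\<close>; values of sequences at index 0 are never used.\<close>

definition fundamental_system :: "(cord \<Rightarrow> nat \<Rightarrow> cord) \<Rightarrow> bool" where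
  "fundamental_system lam \<longleftrightarrow>
    (\<forall>l. is_limit l \<longrightarrow>
      strict_mono_on {1..} (lam l) \<and>
      (\<forall>n\<ge>1. is_succ (lam l n) \<and> lam l n < l) \<and>
      (SUP n\<in>{1..}. lam l n) = l)"

definition set_less :: "nat set \<Rightarrow> nat set \<Rightarrow> bool" where
  "set_less s t \<longleftrightarrow> s \<noteq> {} \<and> t \<noteq> {} \<and> Max s < Min t"

text \<open>The unions \<open>s\<^sub>1 \<union> \<dots> \<union> s\<^sub>p\<close> with \<open>s\<^sub>1 < \<dots> < s\<^sub>p\<close> and all \<open>s\<^sub>i\<close> satisfying \<open>A\<close>.\<close>

definition block_union :: "(nat set \<Rightarrow> bool) \<Rightarrow> nat \<Rightarrow> nat set \<Rightarrow> bool" where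
  "block_union A p s \<longleftrightarrow>
    (\<exists>ts. length ts = p \<and> sorted_wrt set_less ts \<and> (\<forall>t\<in>set ts. A t) \<and> s = \<Union>(set ts))"

lemma block_union_mono [mono]:
  "(\<And>t. A t \<longrightarrow> B t) \<Longrightarrow> block_union A p s \<longrightarrow> block_union B p s"
  unfolding block_union_def by blast

text \<open>\<open>in_schreier lam \<xi> s\<close> is \<open>s \<in> \<A>\<^sub>\<xi>\<close>. The rules concern disjoint ranges of \<open>\<xi>\<close>, and each one
  refers to smaller indices only. In \<open>succ\<close>, \<open>z \<noteq> 0\<close> leaves \<open>\<A>\<^sub>1\<close> to \<open>one\<close>. In \<open>sum\<close>, the list
  \<open>cs\<close> starts with \<open>(\<alpha>, p)\<close> and continues with the pairs \<open>(a\<^sub>i, p\<^sub>i)\<close>, while \<open>ss\<close> lists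
  \<open>s\<^sub>0, s\<^sub>1, \<dots>, s\<^sub>m\<close>, so that it is decreasing.\<close>

inductive in_schreier :: "(cord \<Rightarrow> nat \<Rightarrow> cord) \<Rightarrow> cord \<Rightarrow> nat set \<Rightarrow> bool"
  for lam :: "cord \<Rightarrow> nat \<Rightarrow> cord" where
  zero: "in_schreier lam 0 {}"
| one: "n \<ge> 1 \<Longrightarrow> in_schreier lam 1 {n}"
| succ: "z \<noteq> 0 \<Longrightarrow> n \<ge> 1 \<Longrightarrow> in_schreier lam z s \<Longrightarrow> set_less {n} s \<Longrightarrow>
    in_schreier lam (osuc z) (insert n s)"
| exp_succ: "ts \<noteq> [] \<Longrightarrow> length ts = Min (hd ts) \<Longrightarrow> sorted_wrt set_less ts \<Longrightarrow>
    (\<forall>t\<in>set ts. in_schreier lam (omega_exp b) t) \<Longrightarrow>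
    in_schreier lam (omega_exp (osuc b)) (\<Union>(set ts))"
| exp_limit: "is_limit l \<Longrightarrow> s \<noteq> {} \<Longrightarrow> in_schreier lam (omega_exp (lam l (Min s))) s \<Longrightarrow>
    in_schreier lam (omega_exp l) s"
| sum: "is_limit x \<Longrightarrow> 0 < a \<Longrightarrow> omega_exp a < x \<Longrightarrow> x < omega_exp (osuc a) \<Longrightarrow>
    cs \<noteq> [] \<Longrightarrow> fst (hd cs) = a \<Longrightarrow> sorted_wrt (\<lambda>c d. fst c > fst d) cs \<Longrightarrow>
    (\<forall>(b, q)\<in>set cs. 0 < b \<and> 1 \<le> q) \<Longrightarrow> x = omega_sum cs \<Longrightarrow>
    length ss = length cs \<Longrightarrow> sorted_wrt (\<lambda>s t. set_less t s) ss \<Longrightarrow>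
    (\<forall>i<length cs.
      block_union (in_schreier lam (omega_exp (fst (cs ! i)))) (snd (cs ! i)) (ss ! i)) \<Longrightarrow>
    in_schreier lam x (\<Union>(set ss))"

definition schreier :: "(cord \<Rightarrow> nat \<Rightarrow> cord) \<Rightarrow> cord \<Rightarrow> nat set set" where
  "schreier lam x = {s. in_schreier lam x s}"


section \<open>Located words\<close>

text \<open>A word is a partial function from positions to symbols. The alphabet is
  \<open>{\<alpha> 1, \<alpha> 2, \<dots>}\<close>, the variable is \<open>v\<close>.\<close>

type_synonym 'a word = "nat \<rightharpoonup> 'a"

definition var_words :: "(nat \<Rightarrow> 'a) \<Rightarrow> 'a \<Rightarrow> (nat \<Rightarrow> nat) \<Rightarrow> 'a word set" where
  "var_words \<alpha> v k =
    {w. finite (dom w) \<and> dom w \<noteq> {} \<and> dom w \<subseteq> {1..} \<and>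
        (\<forall>n\<in>dom w. the (w n) \<in> insert v (\<alpha> ` {1..k n})) \<and> v \<in> ran w}"

definition word_less :: "'a word \<Rightarrow> 'a word \<Rightarrow> bool" where
  "word_less w u \<longleftrightarrow> set_less (dom w) (dom u)"

text \<open>For \<open>w < u\<close> the word \<open>w \<star> u\<close> is \<open>w ++ u\<close>, the domains being disjoint.\<close>

definition star_list :: "'a word list \<Rightarrow> 'a word" where
  "star_list ws = foldr (++) ws Map.empty"

definition subst_word :: "(nat \<Rightarrow> 'a) \<Rightarrow> 'a \<Rightarrow> (nat \<Rightarrow> nat) \<Rightarrow> nat \<Rightarrow> 'a word \<Rightarrow> 'a word" where
  "subst_word \<alpha> v k p w =
    (if p = 0 then w else (\<lambda>n. if w n = Some v then Some (\<alpha> (min p (k n))) else w n))"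

definition var_seqs :: "(nat \<Rightarrow> 'a) \<Rightarrow> 'a \<Rightarrow> (nat \<Rightarrow> nat) \<Rightarrow> (nat \<Rightarrow> 'a word) set" where
  "var_seqs \<alpha> v k = {w. \<forall>n\<ge>1. w n \<in> var_words \<alpha> v k \<and> word_less (w n) (w (Suc n))}"

text \<open>In \<open>EV\<close>, the list \<open>xs\<close> consists of the pairs \<open>(n\<^sub>i, p\<^sub>i)\<close>.\<close>

definition EV :: "(nat \<Rightarrow> 'a) \<Rightarrow> 'a \<Rightarrow> (nat \<Rightarrow> nat) \<Rightarrow> (nat \<Rightarrow> 'a word) \<Rightarrow> 'a word set" where
  "EV \<alpha> v k w =
    {star_list (map (\<lambda>(n, p). subst_word \<alpha> v k p (w n)) xs) | xs.
      xs \<noteq> [] \<and> sorted_wrt (\<lambda>x y. fst x < fst y) xs \<and>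
      (\<forall>(n, p)\<in>set xs. 1 \<le> n \<and> p \<le> k n) \<and> (\<exists>(n, p)\<in>set xs. p = 0)}"

definition extraction ::
  "(nat \<Rightarrow> 'a) \<Rightarrow> 'a \<Rightarrow> (nat \<Rightarrow> nat) \<Rightarrow> (nat \<Rightarrow> 'a word) \<Rightarrow> (nat \<Rightarrow> 'a word) \<Rightarrow> bool" where
  "extraction \<alpha> v k u w \<longleftrightarrow> u \<in> var_seqs \<alpha> v k \<and> (\<forall>n\<ge>1. u n \<in> EV \<alpha> v k w)"

definition fin_seqs :: "(nat \<Rightarrow> 'a) \<Rightarrow> 'a \<Rightarrow> (nat \<Rightarrow> nat) \<Rightarrow> 'a word list set" where
  "fin_seqs \<alpha> v k = {ws. set ws \<subseteq> var_words \<alpha> v k \<and> sorted_wrt word_less ws}"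

definition EV_fin ::
  "(nat \<Rightarrow> 'a) \<Rightarrow> 'a \<Rightarrow> (nat \<Rightarrow> nat) \<Rightarrow> (nat \<Rightarrow> 'a word) \<Rightarrow> 'a word list set" where
  "EV_fin \<alpha> v k w = {ws \<in> fin_seqs \<alpha> v k. set ws \<subseteq> EV \<alpha> v k w}"

definition schreier_seqs ::
  "(cord \<Rightarrow> nat \<Rightarrow> cord) \<Rightarrow> cord \<Rightarrow> (nat \<Rightarrow> 'a) \<Rightarrow> 'a \<Rightarrow> (nat \<Rightarrow> nat) \<Rightarrow> 'a word list set" where
  "schreier_seqs lam x \<alpha> v k =
    (if x = 0 then {[]}
     else {ws \<in> fin_seqs \<alpha> v k. (\<lambda>w. Min (dom w)) ` set ws \<in> schreier lam x})"

end

theory Submission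
  imports Defs
begin

text \<open>Only one property of \<open>\<A>\<^sub>\<xi>\<close> matters: it is thin, that is, no member is a proper initial segment
  of another one; this rests on the uniqueness of Cantor normal forms. For thin families the
  theorem is a Nash-Williams dichotomy: applied to \<open>\<F> \<inter> L\<^sup>\<xi>\<close>, it yields an extraction \<open>u\<close> such that
  either \<open>EV\<^sup><\<^sup>\<infinity>(u)\<close> misses \<open>\<F> \<inter> L\<^sup>\<xi>\<close>, or every extraction of \<open>u\<close> has an initial segment in \<open>\<F> \<inter> L\<^sup>\<xi>\<close>.
  In the second case any member of \<open>L\<^sup>\<xi> \<inter> EV\<^sup><\<^sup>\<infinity>(u)\<close> extends to an extraction of \<open>u\<close>, and by thinness
  it is the initial segment in question. The dichotomy follows by combinatorial forcing and fusion
  from the case of single words, a pigeonhole principle of Carlson's type that is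
  proved with idempotent ultrafilters.\<close>

section \<open>Ultrafilters on a semigroup\<close>

text \<open>Members of \<open>ev w\<close> mix variable factors, at least one, with constant
  factors, so a single idempotent does not control them. What is needed is \<open>r\<close> on
  constant words together with \<open>q\<close> on variable words that absorbs \<open>r\<close> on
  both sides and is sent to \<open>r\<close> by the substitutions that occur. Minimality of
  \<open>r\<close> forces the last property. The bounds \<open>p \<le> k n\<close> refer to the
  index of a word in its sequence and not to the word itself. Hence rewriting a word over another
  sequence must never lower an index; then monotonicity of \<open>k\<close> preserves the bounds.
  This governs extractions, shifts and the gluing of sequences alike. Fusion is used twice in the
  forcing argument: once to have every finite sequence decided, and once to make rejection pass on
  to one-term extensions.\<close>

definition ultra :: "'a filter \<Rightarrow> bool" where
  "ultra U \<longleftrightarrow> U \<noteq> bot \<and> (\<forall>P. eventually P U \<or> eventually (\<lambda>x. \<not> P x) U)"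

lemma ultra_not_iff:
  assumes "ultra U"
  shows "eventually (\<lambda>x. \<not> P x) U \<longleftrightarrow> \<not> eventually P U"
proof -
  have "\<not> (eventually P U \<and> eventually (\<lambda>x. \<not> P x) U)"
    using assms eventually_conj[of P U "\<lambda>x. \<not> P x"] by (auto simp: ultra_def trivial_limit_def)
  then show ?thesis using assms by (auto simp: ultra_def)
qed

text \<open>The order on filters is reversed inclusion, so ultrafilters are the minimal proper
  filters. This turns inequalities between products of ultrafilters into equations.\<close>

lemma ultra_eqI: "ultra U \<Longrightarrow> F \<le> U \<Longrightarrow> F \<noteq> bot \<Longrightarrow> F = U"
proof (rule antisym, assumption, rule filter_leI)
  fix P assume U: "ultra U" "F \<le> U" "F \<noteq> bot" and P: "eventually P F"
  show "eventually P U"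
  proof (rule ccontr)
    assume "\<not> eventually P U"
    then have "eventually (\<lambda>x. \<not> P x) F" using U by (simp add: filter_leD flip: ultra_not_iff)
    with P have "eventually (\<lambda>x. P x \<and> \<not> P x) F" by (rule eventually_conj)
    with U(3) show False by simp
  qed
qed

text \<open>Zorn's lemma and compactness: the infimum of a chain of proper filters is proper, since
  whatever holds eventually for it holds eventually for one member. \<open>Q\<close> will be no
  condition at all, being a closed subsemigroup, or being a closed left ideal.\<close>

lemma minimal_filter_exists:
  fixes F :: "'a filter"
  assumes "F \<noteq> bot" and "Q F"
    and chain: "\<And>\<C>. \<C> \<noteq> {} \<Longrightarrow> (\<And>G. G \<in> \<C> \<Longrightarrow> G \<le> F \<and> Q G) \<Longrightarrow> Q (Inf \<C>)"
  obtains M where "M \<le> F" "M \<noteq> bot" "Q M"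
    "\<And>G. G \<le> M \<Longrightarrow> G \<noteq> bot \<Longrightarrow> Q G \<Longrightarrow> G = M"
proof -
  let ?A = "{G. G \<le> F \<and> G \<noteq> bot \<and> Q G}"
  have "\<exists>M\<in>?A. \<forall>G\<in>?A. G \<le> M \<longrightarrow> G = M"
  proof (rule predicate_Zorn)
    show "partial_order_on ?A (relation_of (\<lambda>x y. y \<le> x) ?A)"
      by (rule partial_order_on_relation_ofI) auto
    fix \<C> assume C: "\<C> \<in> Chains (relation_of (\<lambda>x y. y \<le> x) ?A)"
    show "\<exists>u\<in>?A. \<forall>a\<in>\<C>. u \<le> a"
    proof (cases "\<C> = {}")
      case True
      then show ?thesis using assms(1,2) by auto
    next
      case False
      have in_A: "\<C> \<subseteq> ?A" using C by (auto simp: Chains_def relation_of_def)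
      have lin: "G \<le> H \<or> H \<le> G" if "G \<in> \<C>" "H \<in> \<C>" for G H
        using C that by (auto simp: Chains_def relation_of_def)
      have "eventually P (Inf \<C>) \<longleftrightarrow> (\<exists>b\<in>\<C>. eventually P b)" for P
        by (rule eventually_Inf_base[OF False]) (metis lin inf.absorb1 inf.absorb2 order_refl)
      then have "Inf \<C> \<noteq> bot" using in_A by (auto simp: trivial_limit_def)
      moreover have "Inf \<C> \<le> F" using False in_A by (auto intro: Inf_lower2)
      moreover have "Q (Inf \<C>)" using False in_A by (intro chain) auto
      ultimately show ?thesis by (auto intro: Inf_lower)
    qed
  qed
  then show thesis using that by (blast intro: order_trans)
qed

lemma ultra_exists:
  assumes "F \<noteq> bot"
  obtains U where "ultra U" "U \<le> F"
proof -
  obtain M where M: "M \<le> F" "M \<noteq> bot" and min: "\<And>G. G \<le> M \<Longrightarrow> G \<noteq> bot \<Longrightarrow> G = M"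
    using minimal_filter_exists[OF assms, of "\<lambda>_. True"] by metis
  have "eventually P M \<or> eventually (\<lambda>x. \<not> P x) M" for P
  proof (rule disjCI)
    assume "\<not> eventually (\<lambda>x. \<not> P x) M"
    then have "inf M (principal {x. P x}) \<noteq> bot"
      by (simp add: trivial_limit_def eventually_inf_principal)
    then have "inf M (principal {x. P x}) = M" by (intro min) auto
    then have "M \<le> principal {x. P x}" by (simp add: inf.absorb_iff1)
    then show "eventually P M" by (simp add: le_principal)
  qed
  with M that show thesis by (auto simp: ultra_def)
qed

lemma ultra_filtermap: "ultra U \<Longrightarrow> ultra (filtermap h U)"
  by (auto simp: ultra_def eventually_filtermap filtermap_bot_iff)

section \<open>Convolution of filters and its residual\<close>

context semigroup
begin

text \<open>On ultrafilters this is the product of the Stone-Cech compactification that is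
  continuous in the left factor. The same formula for filters allows a closed set to be multiplied
  by a point on its right.\<close>

definition fprod :: "'a filter \<Rightarrow> 'a filter \<Rightarrow> 'a filter" where
  "fprod F G = Abs_filter (\<lambda>P. \<forall>\<^sub>F x in F. \<forall>\<^sub>F y in G. P (x \<^bold>* y))"

lemma eventually_fprod: "eventually P (fprod F G) \<longleftrightarrow> (\<forall>\<^sub>F x in F. \<forall>\<^sub>F y in G. P (x \<^bold>* y))"
  unfolding fprod_def
  by (rule eventually_Abs_filter)
     (auto simp: is_filter_def eventually_conj_iff elim!: eventually_mono)

lemma fprod_mono: "F \<le> F' \<Longrightarrow> G \<le> G' \<Longrightarrow> fprod F G \<le> fprod F' G'"
  by (auto simp: le_filter_def eventually_fprod elim!: eventually_mono)

lemma fprod_assoc: "fprod (fprod F G) H = fprod F (fprod G H)"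
  by (simp add: filter_eq_iff eventually_fprod assoc)

lemma fprod_not_bot: "F \<noteq> bot \<Longrightarrow> G \<noteq> bot \<Longrightarrow> fprod F G \<noteq> bot"
  by (simp add: trivial_limit_def eventually_fprod)

lemma ultra_fprod: "ultra p \<Longrightarrow> ultra q \<Longrightarrow> ultra (fprod p q)"
  unfolding ultra_def[of "fprod p q"]
  by (simp add: eventually_fprod ultra_not_iff fprod_not_bot ultra_def[THEN iffD1, THEN conjunct1])

lemma filtermap_fprod:
  assumes "\<And>x y. h (x \<^bold>* y) = h x \<^bold>* h y"
  shows "filtermap h (fprod F G) = fprod (filtermap h F) (filtermap h G)"
  by (simp add: filter_eq_iff eventually_fprod eventually_filtermap assms)

text \<open>The preimage of the closed set \<open>u\<close> under right multiplication by
  \<open>q\<close>; \<open>le_fres_iff\<close> is the adjunction with \<open>fprod\<close>.\<close>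

definition fres :: "'a filter \<Rightarrow> 'a filter \<Rightarrow> 'a filter" where
  "fres q u = Abs_filter (\<lambda>A. \<exists>P. eventually P u \<and> (\<forall>x. (\<forall>\<^sub>F y in q. P (x \<^bold>* y)) \<longrightarrow> A x))"

lemma eventually_fres:
  "eventually A (fres q u) \<longleftrightarrow> (\<exists>P. eventually P u \<and> (\<forall>x. (\<forall>\<^sub>F y in q. P (x \<^bold>* y)) \<longrightarrow> A x))"
  unfolding fres_def
proof (rule eventually_Abs_filter, rule is_filter.intro, goal_cases)
  case (2 A B)
  then obtain P Q where "eventually P u" "\<forall>x. (\<forall>\<^sub>F y in q. P (x \<^bold>* y)) \<longrightarrow> A x"
    and "eventually Q u" "\<forall>x. (\<forall>\<^sub>F y in q. Q (x \<^bold>* y)) \<longrightarrow> B x" by auto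
  then show ?case by (intro exI[of _ "\<lambda>x. P x \<and> Q x"]) (auto simp: eventually_conj_iff)
qed (auto intro: exI[of _ "\<lambda>_. True"])

lemma le_fres_iff: "X \<le> fres q u \<longleftrightarrow> fprod X q \<le> u"
proof
  assume "X \<le> fres q u"
  then show "fprod X q \<le> u"
    by (intro filter_leI, unfold eventually_fprod, elim filter_leD) (auto simp: eventually_fres)
next
  assume le: "fprod X q \<le> u"
  show "X \<le> fres q u"
  proof (rule filter_leI)
    fix A assume "eventually A (fres q u)"
    then obtain P where P: "eventually P u" "\<And>x. \<forall>\<^sub>F y in q. P (x \<^bold>* y) \<Longrightarrow> A x"
      unfolding eventually_fres by blast
    from filter_leD[OF le P(1)] show "eventually A X"
      unfolding eventually_fprod by (rule eventually_mono) (rule P(2))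
  qed
qed

text \<open>Properness means that \<open>p q = u\<close> has a solution \<open>p\<close> in the
  closed set \<open>F\<close>. Otherwise some \<open>P\<close> eventually true for \<open>u\<close>
  would be eventually false for \<open>fprod F q\<close>, and hence for \<open>u\<close>.\<close>

lemma fres_inf_not_bot:
  assumes "ultra q" "ultra u" "u \<le> fprod F q"
  shows "inf F (fres q u) \<noteq> bot"
proof
  assume "inf F (fres q u) = bot"
  then have "eventually (\<lambda>_. False) (inf F (fres q u))" by simp
  then obtain A B where A: "eventually A F" and B: "eventually B (fres q u)"
    and AB: "\<And>x. A x \<Longrightarrow> B x \<Longrightarrow> False"
    unfolding eventually_inf by blast
  from B obtain P where P: "eventually P u" and PB: "\<And>x. \<forall>\<^sub>F y in q. P (x \<^bold>* y) \<Longrightarrow> B x"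
    unfolding eventually_fres by blast
  from A have "\<forall>\<^sub>F x in F. \<forall>\<^sub>F y in q. \<not> P (x \<^bold>* y)"
    by (rule eventually_mono) (use AB PB ultra_not_iff[OF assms(1)] in blast)
  then have "eventually (\<lambda>x. \<not> P x) u"
    using assms(3) by (simp add: le_filter_def eventually_fprod)
  with P show False using ultra_not_iff[OF assms(2)] by blast
qed

text \<open>The closed set \<open>fprod F q\<close> contains nothing beyond the actual products: the
  image of a compact set under right multiplication by \<open>q\<close> is closed.\<close>

lemma ultra_le_fprod:
  assumes "ultra q" "ultra u" "u \<le> fprod F q"
  obtains p where "ultra p" "p \<le> F" "fprod p q = u"
proof -
  obtain p where p: "ultra p" "p \<le> inf F (fres q u)"
    using ultra_exists[OF fres_inf_not_bot[OF assms]] by metis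
  then have "fprod p q \<le> u" by (simp add: le_fres_iff)
  then have "fprod p q = u"
    using assms p(1) by (intro ultra_eqI) (auto simp: fprod_not_bot ultra_def)
  with p that show thesis by simp
qed

section \<open>Closed subsemigroups, closed left ideals and idempotents\<close>

text \<open>A filter \<open>F\<close> stands for the closed set of the ultrafilters finer than \<open>F\<close>.\<close>

definition left_closed :: "'a filter \<Rightarrow> 'a filter \<Rightarrow> bool" where
  "left_closed D F \<longleftrightarrow> (\<forall>q. ultra q \<longrightarrow> q \<le> F \<longrightarrow> fprod D q \<le> F)"

text \<open>\<open>D\<close> may vary with \<open>F\<close> in order to cover two uses:
  subsemigroups, where each member acts on itself, and left ideals, where one fixed filter acts on
  all members.\<close>

lemma left_closed_Inf: "(\<And>F. F \<in> \<C> \<Longrightarrow> left_closed (D F) F) \<Longrightarrow>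
    (\<And>F. F \<in> \<C> \<Longrightarrow> E \<le> D F) \<Longrightarrow> left_closed E (Inf \<C>)"
  unfolding left_closed_def
proof (intro allI impI Inf_greatest)
  fix q F assume F: "\<And>F. F \<in> \<C> \<Longrightarrow> \<forall>q. ultra q \<longrightarrow> q \<le> F \<longrightarrow> fprod (D F) q \<le> F"
    "\<And>F. F \<in> \<C> \<Longrightarrow> E \<le> D F" "ultra q" "q \<le> Inf \<C>" "F \<in> \<C>"
  then have "fprod (D F) q \<le> F" by (meson Inf_lower order.trans)
  moreover have "fprod E q \<le> fprod (D F) q" using F by (intro fprod_mono) auto
  ultimately show "fprod E q \<le> F" by simp
qed

lemma left_closed_fprod:
  assumes "left_closed D F" "ultra q" "D' \<le> D"
  shows "left_closed D' (fprod F q)"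
  unfolding left_closed_def
proof (intro allI impI)
  fix u assume u: "ultra u" "u \<le> fprod F q"
  obtain p where p: "ultra p" "p \<le> F" "fprod p q = u"
    using ultra_le_fprod[OF assms(2) u] by metis
  have "fprod D' p \<le> F"
    using assms p unfolding left_closed_def by (meson fprod_mono order.trans order_refl)
  then show "fprod D' u \<le> fprod F q"
    by (metis fprod_assoc fprod_mono order_refl p(3))
qed

text \<open>The Ellis-Numakura lemma. For any \<open>q\<close> in a minimal closed subsemigroup
  \<open>M\<close> one has \<open>M q = M\<close>. So the closed subsemigroup of all
  \<open>p\<close> in \<open>M\<close> with \<open>p q = q\<close> is nonempty, hence equal to
  \<open>M\<close>, and \<open>q\<close> belongs to it.\<close>

lemma idempotent_exists:
  assumes "F \<noteq> bot" "left_closed F F"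
  obtains e where "ultra e" "e \<le> F" "fprod e e = e"
proof -
  obtain M where M: "M \<le> F" "M \<noteq> bot" "left_closed M M"
    and min: "\<And>G. G \<le> M \<Longrightarrow> G \<noteq> bot \<Longrightarrow> left_closed G G \<Longrightarrow> G = M"
  proof (rule minimal_filter_exists[of F "\<lambda>G. left_closed G G"])
    fix \<C> :: "'a filter set" assume "\<C> \<noteq> {}" "\<And>G. G \<in> \<C> \<Longrightarrow> G \<le> F \<and> left_closed G G"
    then show "left_closed (Inf \<C>) (Inf \<C>)"
      by (intro left_closed_Inf[where D = "\<lambda>x. x"]) (auto intro: Inf_lower)
  qed (use assms in auto)
  obtain q where q: "ultra q" "q \<le> M" using ultra_exists[OF M(2)] by metis
  have "fprod M q \<le> M" using M(3) q by (simp add: left_closed_def)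
  then have "fprod M q = M"
    using M q by (intro min left_closed_fprod) (auto simp: fprod_not_bot ultra_def)
  then have q': "q \<le> fprod M q" using q by simp
  let ?G = "inf M (fres q q)"
  have "?G = M"
  proof (rule min)
    show "?G \<noteq> bot" using fres_inf_not_bot q q' by blast
    show "left_closed ?G ?G"
      unfolding left_closed_def
    proof (intro allI impI)
      fix r assume r: "ultra r" "r \<le> ?G"
      have "fprod r q = q"
        using r q by (intro ultra_eqI) (auto simp: le_fres_iff fprod_not_bot ultra_def)
      moreover have "fprod ?G q \<le> q" by (simp flip: le_fres_iff)
      ultimately have "fprod (fprod ?G r) q \<le> q" by (simp add: fprod_assoc)
      moreover have "fprod ?G r \<le> fprod M r" by (intro fprod_mono) auto
      then have "fprod ?G r \<le> M" using M(3) r by (auto simp: left_closed_def intro: order_trans)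
      ultimately show "fprod ?G r \<le> ?G" by (simp add: le_fres_iff)
    qed
  qed simp
  then have "q \<le> fres q q" using q(2) by (metis inf.boundedE)
  then have "fprod q q = q"
    using q(1) by (intro ultra_eqI) (auto simp: le_fres_iff fprod_not_bot ultra_def)
  with q M(1) that show thesis by (meson order.trans)
qed

text \<open>\<open>r\<close> is taken in a minimal closed left ideal \<open>M\<close> of
  \<open>D\<close>. An idempotent \<open>s\<close> below \<open>r\<close> lies in \<open>M\<close>
  because \<open>s = s r\<close>. Then \<open>D s = M\<close> contains \<open>r\<close>, so
  \<open>r = p s\<close> for some \<open>p\<close>, and \<open>r s = p s s = r\<close>, while
  \<open>r s = s\<close>.\<close>

lemma minimal_idempotent_exists:
  assumes "D \<noteq> bot" "left_closed D D"
  obtains r where "ultra r" "r \<le> D" "fprod r r = r"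
    "\<And>s. ultra s \<Longrightarrow> s \<le> D \<Longrightarrow> fprod s r = s \<Longrightarrow> fprod r s = s \<Longrightarrow> fprod s s = s \<Longrightarrow> s = r"
proof -
  obtain M where M: "M \<le> D" "M \<noteq> bot" "left_closed D M"
    and min: "\<And>G. G \<le> M \<Longrightarrow> G \<noteq> bot \<Longrightarrow> left_closed D G \<Longrightarrow> G = M"
  proof (rule minimal_filter_exists[of D "left_closed D"])
    fix \<C> :: "'a filter set" assume "\<C> \<noteq> {}" "\<And>G. G \<in> \<C> \<Longrightarrow> G \<le> D \<and> left_closed D G"
    then show "left_closed D (Inf \<C>)" by (intro left_closed_Inf[where D = "\<lambda>_. D"]) auto
  qed (use assms in auto)
  have "left_closed M M"
    using M(1,3) unfolding left_closed_def by (meson fprod_mono order.trans order_refl)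
  then obtain r where r: "ultra r" "r \<le> M" "fprod r r = r" using idempotent_exists M(2) by metis
  show thesis
  proof
    show "ultra r" "r \<le> D" "fprod r r = r" using r M(1) by auto
    fix s assume s: "ultra s" "s \<le> D" "fprod s r = s" "fprod r s = s" "fprod s s = s"
    have "fprod D r \<le> M" using M(3) r by (simp add: left_closed_def)
    then have "s \<le> M" using s by (metis fprod_mono order.trans order_refl)
    then have "fprod D s \<le> M" using M(3) s(1) by (simp add: left_closed_def)
    then have "fprod D s = M"
      using assms s(1) by (intro min left_closed_fprod) (auto simp: fprod_not_bot ultra_def)
    then obtain p where "fprod p s = r"
      using ultra_le_fprod[OF s(1) r(1), of D] r(2) by auto
    then have "fprod r s = r" using s(5) fprod_assoc by metis
    with s show "s = r" by simp
  qed
qed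

end

section \<open>Located words\<close>

text \<open>\<open>++\<close> is total and agrees with the star product on ordered pairs. On
  overlapping domains the right factor wins, but the filters used below concentrate on words far to
  the right, so that only ordered pairs matter.\<close>

interpretation map_add: semigroup "(++) :: 'a word \<Rightarrow> 'a word \<Rightarrow> 'a word"
  by standard simp

text \<open>Unlike \<open>word_less\<close>, this also holds for the empty word, which is the value
  of an empty combination and the start of the construction in
  \<open>pigeonhole_ultra\<close>.\<close>

definition before :: "'a word \<Rightarrow> 'a word \<Rightarrow> bool" where
  "before x y \<longleftrightarrow> (\<forall>m\<in>dom x. \<forall>n\<in>dom y. m < n)"

lemma before_trans: "before x y \<Longrightarrow> before y z \<Longrightarrow> dom y \<noteq> {} \<Longrightarrow> before x z"
  unfolding before_def by (meson ex_in_conv less_trans)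

lemma before_irrefl: "before x x \<Longrightarrow> dom x = {}"
  unfolding before_def by blast

locale located_words =
  fixes \<alpha> :: "nat \<Rightarrow> 'a" and v :: 'a and k :: "nat \<Rightarrow> nat"
  assumes v_notin: "v \<notin> \<alpha> ` {1..}"
    and k_pos: "\<And>n. n \<ge> 1 \<Longrightarrow> 1 \<le> k n"
    and k_mono: "mono_on {1..} k"
begin

abbreviation "words \<equiv> var_words \<alpha> v k"
abbreviation "T \<equiv> subst_word \<alpha> v k"
abbreviation "seqs \<equiv> var_seqs \<alpha> v k"
abbreviation "ev \<equiv> EV \<alpha> v k"
abbreviation "ext \<equiv> extraction \<alpha> v k"

definition comb :: "(nat \<Rightarrow> 'a word) \<Rightarrow> (nat \<times> nat) list \<Rightarrow> 'a word" where
  "comb w xs = star_list (map (\<lambda>(n, p). T p (w n)) xs)"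

text \<open>Does not ask for an entry with \<open>p = 0\<close>, so that constant words and tails of
  combinations are covered too.\<close>

definition valid :: "(nat \<times> nat) list \<Rightarrow> bool" where
  "valid xs \<longleftrightarrow> sorted_wrt (\<lambda>x y. fst x < fst y) xs \<and> (\<forall>(n, p)\<in>set xs. 1 \<le> n \<and> p \<le> k n)"

lemma k_le: "1 \<le> m \<Longrightarrow> m \<le> n \<Longrightarrow> k m \<le> k n"
  using k_mono by (auto simp: mono_on_def)

lemma dom_T [simp]: "dom (T p x) = dom x"
  by (auto simp: subst_word_def split: if_splits)

lemma T_0 [simp]: "T 0 x = x"
  by (simp add: subst_word_def)

lemma T_add: "T p (x ++ y) = T p x ++ T p y"
  by (rule ext) (simp add: subst_word_def map_add_def split: option.splits)

text \<open>A substitution with \<open>p \<noteq> 0\<close> leaves no variable behind, because the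
  inserted letter has index at least 1 and so differs from \<open>v\<close>. Positions must be at
  least 1 for \<open>k n\<close> to be positive.\<close>

lemma T_T: "dom x \<subseteq> {1..} \<Longrightarrow> T q (T p x) = T (if p = 0 then q else p) x"
proof (rule ext)
  fix n assume dom: "dom x \<subseteq> {1..}"
  have "\<alpha> (min p (k n)) \<noteq> v" if "1 \<le> p" "1 \<le> n"
    using v_notin k_pos[OF that(2)] that by (metis atLeast_iff image_eqI min.boundedI)
  then show "T q (T p x) n = T (if p = 0 then q else p) x n"
    using dom by (force simp: subst_word_def)
qed

lemma comb_simps [simp]:
  "comb w [] = Map.empty" "comb w (x # xs) = T (snd x) (w (fst x)) ++ comb w xs"
  "comb w (xs @ ys) = comb w xs ++ comb w ys"
proof -
  show 1: "comb w [] = Map.empty"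
    and 2: "comb w (x # xs) = T (snd x) (w (fst x)) ++ comb w xs" for x xs
    by (simp_all add: comb_def star_list_def split_def)
  show "comb w (xs @ ys) = comb w xs ++ comb w ys"
    by (induction xs) (simp_all add: 1 2)
qed

lemma dom_comb: "dom (comb w xs) = (\<Union>x\<in>set xs. dom (w (fst x)))"
  by (induction xs) auto

lemma valid_simps [simp]:
  "valid []"
  "valid (x # xs) \<longleftrightarrow> 1 \<le> fst x \<and> snd x \<le> k (fst x) \<and> (\<forall>y\<in>set xs. fst x < fst y) \<and> valid xs"
  "valid (xs @ ys) \<longleftrightarrow> valid xs \<and> valid ys \<and> (\<forall>x\<in>set xs. \<forall>y\<in>set ys. fst x < fst y)"
  by (auto simp: valid_def sorted_wrt_append split_def)

lemma validD: "valid xs \<Longrightarrow> (n, p) \<in> set xs \<Longrightarrow> 1 \<le> n \<and> p \<le> k n"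
  by (auto simp: valid_def)

lemma ev_iff: "x \<in> ev w \<longleftrightarrow> (\<exists>xs. x = comb w xs \<and> valid xs \<and> (\<exists>n. (n, 0) \<in> set xs))"
proof
  assume "x \<in> ev w"
  then show "\<exists>xs. x = comb w xs \<and> valid xs \<and> (\<exists>n. (n, 0) \<in> set xs)"
    unfolding EV_def valid_def comb_def by auto
next
  assume "\<exists>xs. x = comb w xs \<and> valid xs \<and> (\<exists>n. (n, 0) \<in> set xs)"
  then obtain xs n where "x = comb w xs" "valid xs" "(n, 0) \<in> set xs" by blast
  then show "x \<in> ev w"
    unfolding EV_def valid_def comb_def by (auto intro!: exI[of _ xs])
qed

lemma wordsD:
  assumes "x \<in> words"
  shows "finite (dom x)" "dom x \<noteq> {}" "dom x \<subseteq> {1..}" "v \<in> ran x"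
    "\<And>n a. x n = Some a \<Longrightarrow> a \<in> insert v (\<alpha> ` {1..k n})"
  using assms unfolding var_words_def by (auto simp: dom_def)

lemma word_less_iff: "x \<in> words \<Longrightarrow> y \<in> words \<Longrightarrow> word_less x y \<longleftrightarrow> before x y"
  using wordsD(1,2)[of x] wordsD(1,2)[of y] by (auto simp: word_less_def set_less_def before_def)

lemma seqsD: "w \<in> seqs \<Longrightarrow> 1 \<le> n \<Longrightarrow> w n \<in> words"
  by (simp add: var_seqs_def)

lemma seqs_before:
  assumes "w \<in> seqs" "1 \<le> m" "m < n"
  shows "before (w m) (w n)"
  using assms(3)
proof (induction n)
  case (Suc n)
  have "before (w n) (w (Suc n))" if "1 \<le> n"
    using assms(1) that word_less_iff by (auto simp: var_seqs_def)
  then show ?case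
    using Suc assms(1,2) wordsD(2)[OF seqsD[of w n]] before_trans[of "w m" "w n" "w (Suc n)"]
    by (cases "m = n") auto
qed simp

lemma seqsI:
  assumes "\<And>n. 1 \<le> n \<Longrightarrow> w n \<in> words" "\<And>n. 1 \<le> n \<Longrightarrow> before (w n) (w (Suc n))"
  shows "w \<in> seqs"
  using assms by (auto simp: var_seqs_def word_less_iff)

text \<open>Recovers the order of indices from the order of words; this is how concatenated index
  lists are seen to be valid.\<close>

lemma before_index:
  assumes "w \<in> seqs" "1 \<le> m" "1 \<le> n" "before (w m) (w n)"
  shows "m < n"
proof (rule ccontr)
  assume "\<not> m < n"
  then have "before (w n) (w m) \<or> n = m" using seqs_before[OF assms(1,3), of m] by auto
  then have "before (w n) (w n)"
    using assms before_trans wordsD(2)[OF seqsD] by metis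
  then show False using before_irrefl wordsD(2)[OF seqsD] assms by metis
qed

text \<open>Each word begins to the right of its predecessor, so indices bound positions from below.
  This is why shifting a sequence by the maximum of a finite set of positions moves it past that
  set.\<close>

lemma seqs_dom_ge:
  assumes "w \<in> seqs" "1 \<le> n" "m \<in> dom (w n)"
  shows "n \<le> m"
  using assms(2,3)
proof (induction n arbitrary: m)
  case (Suc n)
  show ?case
  proof (cases "n = 0")
    case True
    then show ?thesis using Suc.prems wordsD(3)[OF seqsD[OF assms(1)], of 1] by auto
  next
    case False
    then obtain i where i: "i \<in> dom (w n)" using wordsD(2)[OF seqsD[OF assms(1)], of n] by auto
    with False have "n \<le> i" using Suc.IH by simp
    moreover have "i < m"
      using seqs_before[OF assms(1), of n "Suc n"] False i Suc.prems by (auto simp: before_def)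
    ultimately show ?thesis by simp
  qed
qed simp

lemma comb_before_nth:
  assumes "before (comb w xs) (comb w ys)" "x \<in> set xs" "y \<in> set ys"
  shows "before (w (fst x)) (w (fst y))"
  using assms by (fastforce simp: before_def dom_comb)

lemma valid_append:
  assumes "w \<in> seqs" "valid xs" "valid ys" "before (comb w xs) (comb w ys)"
  shows "valid (xs @ ys)"
proof -
  have "fst x < fst y" if "x \<in> set xs" "y \<in> set ys" for x y
    using before_index[OF assms(1)] comb_before_nth[OF assms(4) that] that assms(2,3) validD
    by (metis prod.collapse)
  with assms show ?thesis by simp
qed

lemma ev_words:
  assumes w: "w \<in> seqs"
  shows "ev w \<subseteq> words"
proof
  fix x assume "x \<in> ev w"
  then obtain xs n where x: "x = comb w xs" "valid xs" "(n, 0) \<in> set xs" by (auto simp: ev_iff)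
  have val: "a \<in> insert v (\<alpha> ` {1..k m})" if "valid ys" "comb w ys m = Some a" for ys m a
    using that
  proof (induction ys)
    case (Cons y ys)
    have W: "w (fst y) \<in> words" using Cons w by (simp add: seqsD)
    show ?case
    proof (cases "comb w ys m")
      case None
      then have *: "T (snd y) (w (fst y)) m = Some a" using Cons by (simp add: map_add_def)
      then have "m \<in> dom (T (snd y) (w (fst y)))" by blast
      then have "1 \<le> m" using wordsD(3)[OF W] by auto
      then have "\<alpha> (min p (k m)) \<in> \<alpha> ` {1..k m}" if "p \<noteq> 0" for p
        using that k_pos[of m] by (intro imageI) auto
      then show ?thesis
        using * wordsD(5)[OF W] by (auto simp: subst_word_def split: if_splits)
    qed (use Cons in simp)
  qed simp
  \<comment> \<open>A variable of \<open>w n\<close> survives in the product: only factors to its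
    right could override it in \<open>++\<close>, and their domains lie beyond it.\<close>
  obtain xs1 xs2 where xs: "xs = xs1 @ (n, 0) # xs2" using x(3) by (meson split_list)
  have W: "w n \<in> words" "1 \<le> n" using x w validD seqsD by blast+
  then obtain m where m: "w n m = Some v" using wordsD(4) by (auto simp: ran_def)
  have "m \<notin> dom (comb w xs2)"
  proof
    assume "m \<in> dom (comb w xs2)"
    then obtain y where y: "y \<in> set xs2" "m \<in> dom (w (fst y))" by (auto simp only: dom_comb)
    then have "n < fst y" using x(2) by (simp add: xs)
    with seqs_before[OF w W(2)] m y(2) show False by (fastforce simp: before_def)
  qed
  then have "x m = Some v" using m by (simp add: x xs map_add_def domIff)
  moreover have "w i \<in> words" if "(i, p) \<in> set xs" for i p using x(2) that w validD seqsD by blast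
  then have "finite (dom x)" "dom x \<subseteq> {1..}"
    using wordsD(1) wordsD(3) by (auto simp: x(1) dom_comb)+
  moreover have "the (x n) \<in> insert v (\<alpha> ` {1..k n})" if "n \<in> dom x" for n
    using val[OF x(2), of n "the (x n)"] that by (auto simp flip: x(1))
  ultimately show "x \<in> words" unfolding var_words_def ran_def by blast
qed

lemma ext_seqs: "ext u w \<Longrightarrow> u \<in> seqs"
  by (simp add: extraction_def)

lemma ext_ev: "ext u w \<Longrightarrow> 1 \<le> n \<Longrightarrow> u n \<in> ev w"
  by (simp add: extraction_def)

lemma extI:
  assumes "w \<in> seqs" "\<And>n. 1 \<le> n \<Longrightarrow> u n \<in> ev w" "\<And>n. 1 \<le> n \<Longrightarrow> before (u n) (u (Suc n))"
  shows "ext u w"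
  using assms ev_words[OF assms(1)] by (auto simp: extraction_def intro!: seqsI)

lemma nth_in_ev: "1 \<le> n \<Longrightarrow> w n \<in> ev w"
  unfolding ev_iff by (rule exI[of _ "[(n, 0)]"]) simp

lemma ext_refl: "w \<in> seqs \<Longrightarrow> ext w w"
  by (simp add: extraction_def nth_in_ev)

text \<open>Induction on \<open>j\<close>: the terms of \<open>w\<close> inside
  \<open>u (Suc j)\<close> come after those inside \<open>u j\<close>, so their indices exceed an
  index that is at least \<open>j\<close>.\<close>

lemma ext_index_le:
  assumes "ext u w" "w \<in> seqs" "1 \<le> j" "u j = comb w xs" "valid xs" "(n, p) \<in> set xs"
  shows "j \<le> n"
  using assms(3-)
proof (induction j arbitrary: xs n p)
  case (Suc j)
  show ?case
  proof (cases "j = 0")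
    case True
    then show ?thesis using Suc.prems validD by auto
  next
    case False
    then obtain ys m where ys: "u j = comb w ys" "valid ys" "(m, 0) \<in> set ys"
      using ext_ev[OF assms(1), of j] by (auto simp: ev_iff)
    have "before (comb w ys) (comb w xs)"
      using seqs_before[OF ext_seqs[OF assms(1)], of j "Suc j"] False ys Suc.prems by simp
    then have "m < n"
      using comb_before_nth ys(3) Suc.prems before_index[OF assms(2)] validD ys(2)
      by (metis fst_conv)
    moreover have "j \<le> m" using Suc.IH ys False by auto
    ultimately show ?thesis by simp
  qed
qed simp

lemma T_comb:
  assumes "w \<in> seqs" "valid xs"
  shows "T p (comb w xs) = comb w (map (\<lambda>(n, q). (n, if q = 0 then p else q)) xs)"
  using assms(2)
proof (induction xs)
  case (Cons x xs)
  then show ?case using wordsD(3)[OF seqsD[OF assms(1)], of "fst x"]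
    by (simp add: T_add T_T split: prod.splits)
qed (simp add: subst_word_def)

text \<open>The bound \<open>p\<^sub>i \<le> k\<^sub>n\<close> survives the passage from \<open>u\<close> to \<open>w\<close> because the \<open>j\<close>-th term of
  \<open>u\<close> only involves terms of \<open>w\<close> with index at least \<open>j\<close> and because \<open>k\<close> is increasing.\<close>

lemma comb_ext:
  assumes "ext u w" "w \<in> seqs" "valid ys"
  shows "\<exists>xs. valid xs \<and> comb w xs = comb u ys \<and>
    ((\<exists>n. (n, 0) \<in> set ys) \<longrightarrow> (\<exists>n. (n, 0) \<in> set xs))"
  using assms(3)
proof (induction ys)
  case Nil
  show ?case by (rule exI[of _ "[]"]) simp
next
  case (Cons y ys)
  obtain j p where y: "y = (j, p)" by force
  have j: "1 \<le> j" "p \<le> k j" using Cons.prems by (auto simp: y)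
  obtain xs where xs: "valid xs" "comb w xs = comb u ys"
    "(\<exists>n. (n, 0) \<in> set ys) \<longrightarrow> (\<exists>n. (n, 0) \<in> set xs)" using Cons by auto
  obtain zs m where zs: "u j = comb w zs" "valid zs" "(m, 0) \<in> set zs"
    using ext_ev[OF assms(1) j(1)] by (auto simp: ev_iff)
  let ?zs = "map (\<lambda>(n, q). (n, if q = 0 then p else q)) zs"
  have eq: "comb w ?zs = T p (u j)" using T_comb[OF assms(2) zs(2)] zs(1) by simp
  have "p \<le> k n" if "(n, q) \<in> set zs" for n q
    using ext_index_le[OF assms(1,2) j(1) zs(1,2) that] j k_le by (meson le_trans)
  then have valid: "valid ?zs"
    using zs(2) by (auto simp: valid_def sorted_wrt_map split_def)
  have "before (u j) (u (fst y'))" if "y' \<in> set ys" for y'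
    using Cons.prems that by (auto simp: y intro: seqs_before[OF ext_seqs[OF assms(1)]])
  then have "before (comb w ?zs) (comb w xs)"
    unfolding eq xs(2) by (force simp: before_def dom_comb)
  then have "valid (?zs @ xs)" using valid_append assms(2) valid xs(1) by blast
  moreover have "comb w (?zs @ xs) = comb u (y # ys)" using eq xs(2) by (simp add: y)
  moreover have "(m, p) \<in> set ?zs" using zs(3) by force
  then have "(\<exists>n. (n, 0) \<in> set (y # ys)) \<longrightarrow> (\<exists>n. (n, 0) \<in> set (?zs @ xs))"
    using xs(3) by (auto simp: y)
  ultimately show ?case by blast
qed

lemma ev_ext: "ext u w \<Longrightarrow> w \<in> seqs \<Longrightarrow> ev u \<subseteq> ev w"
  unfolding subset_iff ev_iff by (metis comb_ext)

lemma ext_trans: "ext t u \<Longrightarrow> ext u w \<Longrightarrow> w \<in> seqs \<Longrightarrow> ext t w"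
  using ev_ext[of u w] by (auto simp: extraction_def)

end

section \<open>The pigeonhole principle for variable words\<close>

text \<open>Stands for the closed set of ultrafilters that contain \<open>A\<close> and concentrate
  beyond every position.\<close>

definition tail :: "'a word set \<Rightarrow> 'a word filter" where
  "tail A = (INF n. principal {x \<in> A. dom x \<subseteq> {n<..}})"

lemma eventually_tail: "eventually P (tail A) \<longleftrightarrow> (\<exists>n. \<forall>x\<in>A. dom x \<subseteq> {n<..} \<longrightarrow> P x)"
  unfolding tail_def
proof (subst eventually_INF_base)
  fix m n :: nat
  show "\<exists>i\<in>UNIV. principal {x \<in> A. dom x \<subseteq> {i<..}} \<le>
    inf (principal {x \<in> A. dom x \<subseteq> {m<..}}) (principal {x \<in> A. dom x \<subseteq> {n<..}})"
    by (rule bexI[of _ "max m n"]) auto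
qed (auto simp: eventually_principal)

lemma eventually_in_tail: "F \<le> tail A \<Longrightarrow> eventually (\<lambda>x. x \<in> A \<and> dom x \<subseteq> {n<..}) F"
  by (rule filter_leD) (auto simp: eventually_tail intro: exI[of _ n])

lemma tail_not_bot: "(\<And>n. \<exists>x\<in>A. dom x \<subseteq> {n<..}) \<Longrightarrow> tail A \<noteq> bot"
  by (auto simp: trivial_limit_def eventually_tail)

text \<open>The domain of a fixed \<open>x\<close> in \<open>A\<close> is finite, so almost every
  \<open>y\<close> for \<open>G\<close> lies beyond it. Closure under ordered products is therefore
  enough.\<close>

lemma fprod_tail_le:
  assumes fin: "\<And>x. x \<in> A \<Longrightarrow> finite (dom x)"
    and closed: "\<And>x y. x \<in> A \<Longrightarrow> y \<in> B \<Longrightarrow> before x y \<Longrightarrow> x ++ y \<in> C"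
    and le: "F \<le> tail A" "G \<le> tail B"
  shows "map_add.fprod F G \<le> tail C"
proof (rule filter_leI)
  fix P assume "eventually P (tail C)"
  then obtain n where n: "\<And>x. x \<in> C \<Longrightarrow> dom x \<subseteq> {n<..} \<Longrightarrow> P x" by (auto simp: eventually_tail)
  show "eventually P (map_add.fprod F G)"
    unfolding map_add.eventually_fprod
  proof (rule eventually_mono[OF eventually_in_tail[OF le(1), of n]])
    fix x assume x: "x \<in> A \<and> dom x \<subseteq> {n<..}"
    show "\<forall>\<^sub>F y in G. P (x ++ y)"
    proof (rule eventually_mono[OF eventually_in_tail[OF le(2), of "Max (insert n (dom x))"]])
      fix y assume y: "y \<in> B \<and> dom y \<subseteq> {Max (insert n (dom x))<..}"
      have "i < j" if "i \<in> insert n (dom x)" "j \<in> dom y" for i j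
        using that y fin[of x] x Max_ge[of "insert n (dom x)" i] by fastforce
      then have "before x y" "dom y \<subseteq> {n<..}" unfolding before_def by blast+
      then show "P (x ++ y)" using x y closed by (intro n) auto
    qed
  qed
qed

context located_words
begin

text \<open>The constant counterpart of \<open>ev\<close>. The condition
  \<open>xs \<noteq> []\<close> keeps out the empty word, which would count as lying beyond every
  position.\<close>

definition cv :: "(nat \<Rightarrow> 'a word) \<Rightarrow> 'a word set" where
  "cv w = {comb w xs | xs. xs \<noteq> [] \<and> valid xs \<and> (\<forall>x\<in>set xs. snd x \<noteq> 0)}"

lemma add_combs:
  assumes "w \<in> seqs" "before x y"
  shows "x \<in> cv w \<Longrightarrow> y \<in> cv w \<Longrightarrow> x ++ y \<in> cv w"
    and "x \<in> ev w \<Longrightarrow> y \<in> cv w \<Longrightarrow> x ++ y \<in> ev w"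
    and "x \<in> cv w \<Longrightarrow> y \<in> ev w \<Longrightarrow> x ++ y \<in> ev w"
    and "x \<in> ev w \<Longrightarrow> y \<in> ev w \<Longrightarrow> x ++ y \<in> ev w"
proof -
  have *: "\<exists>zs. x ++ y = comb w zs \<and> valid zs \<and> set zs = set xs \<union> set ys"
    if "x = comb w xs" "y = comb w ys" "valid xs" "valid ys" for xs ys
    using that assms valid_append[OF assms(1) that(3,4)] by (intro exI[of _ "xs @ ys"]) simp
  show "x \<in> cv w \<Longrightarrow> y \<in> cv w \<Longrightarrow> x ++ y \<in> cv w"
    unfolding cv_def mem_Collect_eq using * by (metis (no_types, lifting) Un_iff Un_empty set_empty)
  show "x \<in> ev w \<Longrightarrow> y \<in> cv w \<Longrightarrow> x ++ y \<in> ev w"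
    "x \<in> cv w \<Longrightarrow> y \<in> ev w \<Longrightarrow> x ++ y \<in> ev w"
    "x \<in> ev w \<Longrightarrow> y \<in> ev w \<Longrightarrow> x ++ y \<in> ev w"
    unfolding cv_def ev_iff mem_Collect_eq using * by (metis Un_iff)+
qed

lemma finite_dom_ev: "w \<in> seqs \<Longrightarrow> x \<in> ev w \<Longrightarrow> finite (dom x)"
  using ev_words wordsD(1) by blast

lemma finite_dom_cv: "w \<in> seqs \<Longrightarrow> x \<in> cv w \<Longrightarrow> finite (dom x)"
  unfolding cv_def by (force simp: dom_comb intro: wordsD(1)[OF seqsD] dest: validD)

lemma dom_nth_gt: "w \<in> seqs \<Longrightarrow> dom (w (Suc n)) \<subseteq> {n<..}"
  using seqs_dom_ge[of w "Suc n"] by (auto intro: Suc_le_lessD)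

text \<open>The value \<open>p\<close> has to be admissible at every index that occurs in
  \<open>x\<close>. Beyond \<open>w n\<close> only indices above \<open>n\<close> occur, where
  \<open>k\<close> is at least \<open>k n\<close>.\<close>

lemma T_ev_cv:
  assumes "w \<in> seqs" "x \<in> ev w" "1 \<le> p" "1 \<le> n" "p \<le> k n" "before (w n) x"
  shows "T p x \<in> cv w"
proof -
  obtain xs m where xs: "x = comb w xs" "valid xs" "(m, 0) \<in> set xs"
    using assms(2) by (auto simp: ev_iff)
  have "p \<le> k i" if "(i, j) \<in> set xs" for i j
  proof -
    have "before (w n) (w i)" using assms(6) that by (force simp: xs before_def dom_comb)
    then have "n < i" using before_index assms(1,4) validD[OF xs(2) that] by blast
    then show ?thesis using k_le[of n i] assms(4,5) by simp
  qed
  then have "valid (map (\<lambda>(n, q). (n, if q = 0 then p else q)) xs)"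
    using xs(2) by (auto simp: valid_def sorted_wrt_map split_def)
  moreover have "xs \<noteq> []" using xs(3) by auto
  ultimately show ?thesis
    unfolding cv_def xs(1) T_comb[OF assms(1) xs(2)] using assms(3)
    by (intro CollectI exI[of _ "map (\<lambda>(n, q). (n, if q = 0 then p else q)) xs"]) auto
qed

lemma T_cv:
  assumes "w \<in> seqs" "x \<in> cv w"
  shows "T p x = x"
proof -
  obtain xs where xs: "x = comb w xs" "valid xs" "\<forall>x\<in>set xs. snd x \<noteq> 0"
    using assms(2) by (auto simp: cv_def)
  have "map (\<lambda>(n, q). (n, if q = 0 then p else q)) xs = xs"
    using xs(3) by (intro map_idI) auto
  then show ?thesis using T_comb[OF assms(1) xs(2)] xs(1) by simp
qed

text \<open>Take \<open>r\<close> to be a minimal idempotent among the ultrafilters on constant words and \<open>q\<close> an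
  idempotent below \<open>r\<close> living on variable words. Substitution maps \<open>q\<close> to an idempotent below
  \<open>r\<close> living on constant words, hence to \<open>r\<close> itself.\<close>

lemma idempotent_pair:
  assumes w: "w \<in> seqs"
  obtains q r where "ultra q" "ultra r" "q \<le> tail (ev w)"
    "map_add.fprod q q = q" "map_add.fprod q r = q"
    "map_add.fprod r q = q" "map_add.fprod r r = r"
    "\<And>p n. 1 \<le> p \<Longrightarrow> 1 \<le> n \<Longrightarrow> p \<le> k n \<Longrightarrow> filtermap (T p) q = r"
proof -
  let ?L = "tail (cv w)" and ?V = "tail (ev w)"
  note fin = finite_dom_ev[OF w] finite_dom_cv[OF w]
  note le = fprod_tail_le[OF fin(2) add_combs(1)[OF w]] fprod_tail_le[OF fin(1) add_combs(2)[OF w]]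
    fprod_tail_le[OF fin(2) add_combs(3)[OF w]] fprod_tail_le[OF fin(1) add_combs(4)[OF w]]
  have "T 1 (w (Suc n)) \<in> cv w" for n
    using k_pos[of "Suc n"] unfolding cv_def by (intro CollectI exI[of _ "[(Suc n, 1)]"]) simp
  then have "?L \<noteq> bot"
    by (intro tail_not_bot) (metis dom_T dom_nth_gt[OF w])
  moreover have "map_add.left_closed ?L ?L" using le(1) by (simp add: map_add.left_closed_def)
  ultimately obtain r where r: "ultra r" "r \<le> ?L" "map_add.fprod r r = r"
    and min: "\<And>s. ultra s \<Longrightarrow> s \<le> ?L \<Longrightarrow> map_add.fprod s r = s \<Longrightarrow> map_add.fprod r s = s \<Longrightarrow>
      map_add.fprod s s = s \<Longrightarrow> s = r"
    using map_add.minimal_idempotent_exists by metis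
  \<comment> \<open>The products \<open>p r\<close> form a closed subsemigroup, and each of its
    elements \<open>e\<close> satisfies \<open>e r = e\<close>.\<close>
  let ?J = "map_add.fprod ?V r"
  have J: "?J \<le> ?V" using le(2) r(2) by simp
  have "?V \<noteq> bot"
    by (intro tail_not_bot) (metis dom_nth_gt[OF w] nth_in_ev le_add1 plus_1_eq_Suc)
  then have "?J \<noteq> bot" using r(1) by (simp add: map_add.fprod_not_bot ultra_def)
  moreover have "map_add.left_closed ?V ?V" using le(4) by (simp add: map_add.left_closed_def)
  then have "map_add.left_closed ?J ?J" using r(1) J by (rule map_add.left_closed_fprod)
  ultimately obtain e where e: "ultra e" "e \<le> ?J" "map_add.fprod e e = e"
    using map_add.idempotent_exists by metis
  obtain p where "map_add.fprod p r = e" using map_add.ultra_le_fprod[OF r(1) e(1,2)] by metis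
  then have er: "map_add.fprod e r = e" using r(3) map_add.fprod_assoc by metis
  \<comment> \<open>Multiplying by \<open>r\<close> from the left adds \<open>r q = q\<close> to
    \<open>e r = e\<close> and keeps idempotence: \<open>r e r e = r e e = r e\<close>.\<close>
  define q where "q = map_add.fprod r e"
  have q: "ultra q" unfolding q_def using r(1) e(1) by (rule map_add.ultra_fprod)
  have qV: "q \<le> ?V" unfolding q_def using le(3) r(2) e(2) J by simp
  have rq: "map_add.fprod r q = q" unfolding q_def by (metis r(3) map_add.fprod_assoc)
  have qr: "map_add.fprod q r = q" unfolding q_def by (metis er map_add.fprod_assoc)
  have qq: "map_add.fprod q q = q" unfolding q_def by (metis er e(3) map_add.fprod_assoc)
  show thesis
  proof
    fix p n assume p: "1 \<le> p" "1 \<le> n" "p \<le> k n"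
    let ?s = "filtermap (T p) q"
    have "filtermap (T p) r = r"
    proof (rule filter_eq_iff[THEN iffD2], rule allI)
      fix P
      have "\<forall>\<^sub>F x in r. P (T p x) \<longleftrightarrow> P x"
        using eventually_in_tail[OF r(2), of 0] by (rule eventually_mono) (simp add: T_cv[OF w])
      then show "eventually P (filtermap (T p) r) \<longleftrightarrow> eventually P r"
        unfolding eventually_filtermap by (rule eventually_subst)
    qed
    note hom = map_add.filtermap_fprod[where h = "T p", OF T_add]
    have "?s = r"
    proof (rule min)
      show "ultra ?s" using q by (rule ultra_filtermap)
      \<comment> \<open>\<open>T p\<close> is known to lead from \<open>ev w\<close> to
        \<open>cv w\<close> only for words beyond \<open>w n\<close>; almost all words for
        \<open>q\<close> are of this kind.\<close>
      show "?s \<le> ?L"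
      proof (rule filter_leI)
        fix P assume "eventually P ?L"
        then obtain m where m: "\<And>x. x \<in> cv w \<Longrightarrow> dom x \<subseteq> {m<..} \<Longrightarrow> P x"
          by (auto simp: eventually_tail)
        let ?M = "Max (insert m (dom (w n)))"
        have "finite (dom (w n))" using wordsD(1)[OF seqsD[OF w p(2)]] .
        then have M: "i \<le> ?M" if "i \<in> insert m (dom (w n))" for i using that by (intro Max_ge) auto
        show "eventually P ?s"
          unfolding eventually_filtermap
        proof (rule eventually_mono[OF eventually_in_tail[OF qV, of ?M]])
          fix x assume x: "x \<in> ev w \<and> dom x \<subseteq> {?M<..}"
          have "before (w n) x" unfolding before_def
          proof (intro ballI)
            fix i j assume "i \<in> dom (w n)" "j \<in> dom x"
            then show "i < j" using M[of i] x by auto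
          qed
          moreover have "dom x \<subseteq> {m<..}" using M[of m] x by auto
          ultimately show "P (T p x)" using T_ev_cv[OF w _ p] x by (intro m) auto
        qed
      qed
      show "map_add.fprod ?s r = ?s" "map_add.fprod r ?s = ?s" "map_add.fprod ?s ?s = ?s"
        using hom[of q r] hom[of r q] hom[of q q] qr rq qq \<open>filtermap (T p) r = r\<close> by simp_all
    qed
    then show "filtermap (T p) q = r" .
  qed (fact q r qV qq qr rq)+
qed

text \<open>\<open>E n\<close> and \<open>L n\<close> stand for bounds on the products of the first
  \<open>n\<close> words with and without a remaining variable. The induction splits off the last
  factor, so closure under appending the next word suffices; monotonicity in \<open>n\<close>
  bridges skipped indices.\<close>

lemma comb_ladder:
  assumes E: "\<And>n x p. x \<in> E n \<Longrightarrow> p \<le> k (Suc n) \<Longrightarrow> x ++ T p (u (Suc n)) \<in> E (Suc n)"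
    and L: "\<And>n x p. x \<in> L n \<Longrightarrow> 1 \<le> p \<Longrightarrow> p \<le> k (Suc n) \<Longrightarrow> x ++ T p (u (Suc n)) \<in> L (Suc n)"
    and LE: "\<And>n x. x \<in> L n \<Longrightarrow> x ++ u (Suc n) \<in> E (Suc n)"
    and mono: "\<And>n. E n \<subseteq> E (Suc n)" "\<And>n. L n \<subseteq> L (Suc n)"
    and 0: "Map.empty \<in> L 0"
    and xs: "valid xs" "\<forall>x\<in>set xs. fst x \<le> n"
  shows "comb u xs \<in> (if \<exists>n. (n, 0) \<in> set xs then E n else L n)"
  using xs
proof (induction xs arbitrary: n rule: rev_induct)
  case Nil
  have "L 0 \<subseteq> L n" using mono(2) by (rule lift_Suc_mono_le) simp
  then show ?case using 0 by auto
next
  case (snoc x xs)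
  obtain m p where x: "x = (Suc m, p)" "p \<le> k (Suc m)" "Suc m \<le> n"
    using snoc.prems by (cases x; cases "fst x") auto
  have "comb u xs \<in> (if \<exists>n. (n, 0) \<in> set xs then E m else L m)"
    using snoc.prems x by (intro snoc.IH) auto
  then have "comb u (xs @ [x]) \<in> (if \<exists>n. (n, 0) \<in> set (xs @ [x]) then E (Suc m) else L (Suc m))"
    using E[of _ m p] L[of _ m p] LE[of _ m] x by (cases "p = 0") (auto split: if_splits)
  moreover have "E (Suc m) \<subseteq> E n" "L (Suc m) \<subseteq> L n"
    using x(3) lift_Suc_mono_le[of E, OF mono(1)] lift_Suc_mono_le[of L, OF mono(2)] by auto
  ultimately show ?case by (auto split: if_splits)
qed

text \<open>The Galvin-Glazer construction: words are chosen one at a time such that all products of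
  the chosen words stay good. The equations between \<open>q\<close> and \<open>r\<close> make
  almost every next word preserve goodness, and there are only finitely many products to
  watch.\<close>

lemma pigeonhole_ultra:
  assumes w: "w \<in> seqs" and q: "ultra q" "q \<le> tail (ev w)" and "ultra r"
    and idem: "map_add.fprod q q = q" "map_add.fprod q r = q"
      "map_add.fprod r q = q" "map_add.fprod r r = r"
    and T: "\<And>p n. 1 \<le> p \<Longrightarrow> 1 \<le> n \<Longrightarrow> p \<le> k n \<Longrightarrow> filtermap (T p) q = r"
    and C: "eventually (\<lambda>x. x \<in> C) q"
  shows "\<exists>u. ext u w \<and> ev u \<subseteq> C"
proof -
  \<comment> \<open>Goodness of a partial product. A constant one must lead into \<open>C\<close>
    after almost every variable word; one with a variable must lie in \<open>C\<close> already and
    lead into \<open>C\<close> after variable and constant words alike.\<close>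
  define gL where "gL x \<longleftrightarrow> (\<forall>\<^sub>F y in q. x ++ y \<in> C)" for x
  define gE where "gE x \<longleftrightarrow> x \<in> C \<and> gL x \<and> (\<forall>\<^sub>F y in r. x ++ y \<in> C)" for x
  have split: "eventually P a \<Longrightarrow> map_add.fprod b c = a \<Longrightarrow> \<forall>\<^sub>F x in b. \<forall>\<^sub>F y in c. P (x ++ y)"
    for P and a b c :: "'a word filter"
    by (metis map_add.eventually_fprod)
  have L_q: "\<forall>\<^sub>F z in q. gE (x ++ z)" if "gL x" for x
    using that split[OF _ idem(1), of "\<lambda>y. x ++ y \<in> C"] split[OF _ idem(2), of "\<lambda>y. x ++ y \<in> C"]
    by (simp add: gE_def gL_def eventually_conj_iff)
  have L_r: "\<forall>\<^sub>F z in r. gL (x ++ z)" if "gL x" for x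
    using that split[OF _ idem(3), of "\<lambda>y. x ++ y \<in> C"] by (simp add: gL_def)
  have E_r: "\<forall>\<^sub>F z in r. gE (x ++ z)" if "gE x" for x
    using that L_r[of x] split[OF _ idem(4), of "\<lambda>y. x ++ y \<in> C"]
    by (simp add: gE_def eventually_conj_iff)
  have T_r: "\<forall>\<^sub>F z in q. P (T p z)" if "eventually P r" "1 \<le> p" "p \<le> k (Suc n)" for P p n
    using that T[of p "Suc n"] by (simp flip: eventually_filtermap)
  \<comment> \<open>A state holds the good products of both kinds over the words chosen so far, and
    the last chosen word.\<close>
  define inv where "inv s \<longleftrightarrow> (case s of (E, L, z) \<Rightarrow> finite E \<and> finite L \<and> Ball E gE \<and> Ball L gL \<and>
      Map.empty \<in> L \<and> finite (dom z))" for s :: "'a word set \<times> 'a word set \<times> 'a word"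
  define step where "step n s s' \<longleftrightarrow> (case (s, s') of ((E, L, z), (E', L', z')) \<Rightarrow>
      z' \<in> ev w \<and> before z z' \<and>
      E' = E \<union> (\<lambda>x. x ++ z') ` (E \<union> L) \<union> (\<lambda>(x, p). x ++ T p z') ` (E \<times> {1..k (Suc n)}) \<and>
      L' = L \<union> (\<lambda>(x, p). x ++ T p z') ` (L \<times> {1..k (Suc n)}))"
    for n and s s' :: "'a word set \<times> 'a word set \<times> 'a word"
  have "\<exists>S. \<forall>n. inv (S n) \<and> step n (S n) (S (Suc n))"
  proof (rule dependent_nat_choice)
    \<comment> \<open>For the empty product, goodness is the assumption on \<open>C\<close>. The
      word at index 0 is a placeholder, as valid lists start at index 1.\<close>
    have "gL Map.empty" using C by (simp add: gL_def)
    then show "\<exists>s. inv s" by (intro exI[of _ "({}, {Map.empty}, Map.empty)"]) (simp add: inv_def)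
  next
    fix s n assume s: "inv s"
    obtain E L z where ELz: "s = (E, L, z)" using prod_cases3 by blast
    let ?K = "{1..k (Suc n)}"
    have fin: "finite E" "finite L" "finite (dom z)" and good: "\<And>x. x \<in> E \<Longrightarrow> gE x" "\<And>x. x \<in> L \<Longrightarrow> gL x"
      and empty: "Map.empty \<in> L"
      using s by (auto simp: inv_def ELz)
    have "\<forall>\<^sub>F z' in q. z' \<in> ev w \<and> dom z' \<subseteq> {Max (insert 0 (dom z))<..}"
      using q(2) by (rule eventually_in_tail)
    then have "\<forall>\<^sub>F z' in q. z' \<in> ev w \<and> before z z'"
    proof (rule eventually_mono)
      fix z' assume z': "z' \<in> ev w \<and> dom z' \<subseteq> {Max (insert 0 (dom z))<..}"
      have "i < j" if "i \<in> dom z" "j \<in> dom z'" for i j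
        using that z' fin(3) Max_ge[of "insert 0 (dom z)" i] by fastforce
      with z' show "z' \<in> ev w \<and> before z z'" by (simp add: before_def)
    qed
    \<comment> \<open>Members of \<open>E\<close> satisfy \<open>gL\<close> too, so appending an
      unsubstituted variable word is the same task for \<open>E\<close> and for
      \<open>L\<close>.\<close>
    moreover have "\<forall>\<^sub>F z' in q. \<forall>x\<in>E \<union> L. gE (x ++ z')"
      using fin good by (intro eventually_ball_finite ballI L_q) (auto simp: gE_def)
    moreover have "\<forall>\<^sub>F z' in q. \<forall>x\<in>E. \<forall>p\<in>?K. gE (x ++ T p z')"
      using fin good by (intro eventually_ball_finite ballI T_r E_r) auto
    moreover have "\<forall>\<^sub>F z' in q. \<forall>x\<in>L. \<forall>p\<in>?K. gL (x ++ T p z')"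
      using fin good by (intro eventually_ball_finite ballI T_r L_r) auto
    ultimately have ex: "\<forall>\<^sub>F z' in q. (z' \<in> ev w \<and> before z z') \<and> (\<forall>x\<in>E \<union> L. gE (x ++ z')) \<and>
        (\<forall>x\<in>E. \<forall>p\<in>?K. gE (x ++ T p z')) \<and> (\<forall>x\<in>L. \<forall>p\<in>?K. gL (x ++ T p z'))"
      by (intro eventually_conj) (simp_all add: eventually_conj_iff)
    have "q \<noteq> bot" using q(1) by (simp add: ultra_def)
    from eventually_happens'[OF this ex] obtain z' where z': "z' \<in> ev w" "before z z'" "\<forall>x\<in>E \<union> L. gE (x ++ z')"
        "\<forall>x\<in>E. \<forall>p\<in>?K. gE (x ++ T p z')" "\<forall>x\<in>L. \<forall>p\<in>?K. gL (x ++ T p z')"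
      by (elim exE conjE)
    define E' L' where "E' = E \<union> (\<lambda>x. x ++ z') ` (E \<union> L) \<union> (\<lambda>(x, p). x ++ T p z') ` (E \<times> ?K)"
      and "L' = L \<union> (\<lambda>(x, p). x ++ T p z') ` (L \<times> ?K)"
    have "Ball E' gE" using good(1) z'(3,4) by (auto simp: E'_def)
    moreover have "Ball L' gL" using good(2) z'(5) by (auto simp: L'_def)
    moreover have "finite E'" "finite L'" "Map.empty \<in> L'"
      using fin empty by (simp_all add: E'_def L'_def)
    ultimately have "inv (E', L', z')"
      using finite_dom_ev[OF w z'(1)] unfolding inv_def by blast
    moreover have "step n s (E', L', z')" using z'(1,2) by (simp add: step_def ELz E'_def L'_def)
    ultimately show "\<exists>s'. inv s' \<and> step n s s'" by blast
  qed
  then obtain S where S: "\<And>n. inv (S n)" "\<And>n. step n (S n) (S (Suc n))" by blast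
  define E L u where "E n = fst (S n)" and "L n = fst (snd (S n))" and "u n = snd (snd (S n))" for n
  have S_eq: "S n = (E n, L n, u n)" for n by (simp add: E_def L_def u_def)
  have ev: "u (Suc n) \<in> ev w" and bef: "before (u n) (u (Suc n))"
    and E: "E (Suc n) = E n \<union> (\<lambda>x. x ++ u (Suc n)) ` (E n \<union> L n) \<union>
        (\<lambda>(x, p). x ++ T p (u (Suc n))) ` (E n \<times> {1..k (Suc n)})"
    and L: "L (Suc n) = L n \<union> (\<lambda>(x, p). x ++ T p (u (Suc n))) ` (L n \<times> {1..k (Suc n)})" for n
    using S(2)[of n] by (simp_all add: step_def S_eq)
  have "ext u w"
    using w bef ev by (intro extI) (metis Suc_le_D One_nat_def)+
  moreover have "ev u \<subseteq> C"
  proof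
    fix x assume "x \<in> ev u"
    then obtain xs m where xs: "x = comb u xs" "valid xs" "(m, 0) \<in> set xs" by (auto simp: ev_iff)
    let ?n = "Max (fst ` set xs)"
    have "comb u xs \<in> (if \<exists>n. (n, 0) \<in> set xs then E ?n else L ?n)"
    proof (rule comb_ladder)
      fix n x p assume x: "x \<in> E n" and p: "p \<le> k (Suc n)"
      show "x ++ T p (u (Suc n)) \<in> E (Suc n)"
        using x p by (cases "p = 0") (force simp: E)+
    next
      fix n x p assume x: "x \<in> L n" and p: "1 \<le> p" "p \<le> k (Suc n)"
      show "x ++ T p (u (Suc n)) \<in> L (Suc n)" using x p by (force simp: L)
    next
      show "Map.empty \<in> L 0" using S(1)[of 0] by (simp add: inv_def S_eq)
    qed (use xs in \<open>auto simp: E L\<close>)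
    with xs(3) have "comb u xs \<in> E ?n" by (metis (full_types))
    then show "x \<in> C" using S(1)[of ?n] xs(1) by (auto simp: inv_def S_eq gE_def)
  qed
  ultimately show ?thesis by blast
qed

lemma pigeonhole:
  assumes w: "w \<in> seqs"
  obtains u where "ext u w" "ev u \<subseteq> C \<or> ev u \<inter> C = {}"
proof -
  obtain q r where qr: "ultra q" "ultra r" "q \<le> tail (ev w)"
    "map_add.fprod q q = q" "map_add.fprod q r = q"
    "map_add.fprod r q = q" "map_add.fprod r r = r"
    "\<And>p n. 1 \<le> p \<Longrightarrow> 1 \<le> n \<Longrightarrow> p \<le> k n \<Longrightarrow> filtermap (T p) q = r"
    using idempotent_pair[OF w] by metis
  have *: "\<exists>u. ext u w \<and> ev u \<subseteq> D" if "eventually (\<lambda>x. x \<in> D) q" for D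
    using pigeonhole_ultra[OF w qr(1,3,2,4-7) _ that] qr(8) by blast
  have "eventually (\<lambda>x. x \<in> C) q \<or> eventually (\<lambda>x. x \<in> - C) q"
    using qr(1) by (simp add: ultra_def)
  then show thesis using *[of C] *[of "- C"] that by auto
qed

end

section \<open>Fusion and the Nash-Williams dichotomy\<close>

context located_words
begin

abbreviation "evf \<equiv> EV_fin \<alpha> v k"

lemma evf_iff: "w \<in> seqs \<Longrightarrow> s \<in> evf w \<longleftrightarrow> set s \<subseteq> ev w \<and> sorted_wrt before s"
proof -
  assume w: "w \<in> seqs"
  have "sorted_wrt word_less s \<longleftrightarrow> sorted_wrt before s" if "set s \<subseteq> words" for s
    using that by (induction s) (auto simp: word_less_iff subset_iff)
  then show ?thesis using ev_words[OF w] by (auto simp: EV_fin_def fin_seqs_def)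
qed

lemma evf_ext: "ext u w \<Longrightarrow> w \<in> seqs \<Longrightarrow> evf u \<subseteq> evf w"
  using ev_ext[of u w] by (auto simp: evf_iff ext_seqs subset_iff)

definition after :: "'a word list \<Rightarrow> (nat \<Rightarrow> 'a word) \<Rightarrow> 'a word set" where
  "after s u = {x \<in> ev u. \<forall>y\<in>set s. before y x}"

lemma after_ext: "ext u w \<Longrightarrow> w \<in> seqs \<Longrightarrow> after s u \<subseteq> after s w"
  using ev_ext[of u w] by (auto simp: after_def)

lemma shift_seqs: "w \<in> seqs \<Longrightarrow> (\<lambda>n. w (n + c)) \<in> seqs"
  by (auto intro!: seqsI seqsD seqs_before)

lemma shift_ext: "w \<in> seqs \<Longrightarrow> ext (\<lambda>n. w (n + c)) w"
  by (auto intro!: extI nth_in_ev seqs_before)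

lemma shift_after:
  assumes w: "w \<in> seqs" and s: "set s \<subseteq> words"
  obtains c where "\<And>n. 1 \<le> n \<Longrightarrow> w (n + c) \<in> after s w"
proof
  let ?D = "\<Union>y\<in>set s. dom y"
  fix n :: nat assume n: "1 \<le> n"
  have fin: "finite ?D" using s wordsD(1) by blast
  have "i < j" if "i \<in> ?D" "j \<in> dom (w (n + Max ?D))" for i j
    using Max_ge[OF fin that(1)] seqs_dom_ge[OF w _ that(2)] n by simp
  then show "w (n + Max ?D) \<in> after s w"
    using n by (auto simp: after_def before_def intro: nth_in_ev)
qed

section \<open>Finite stages and fusion\<close>

definition ev_upto :: "nat \<Rightarrow> (nat \<Rightarrow> 'a word) \<Rightarrow> 'a word set" where
  "ev_upto n w = {comb w xs | xs. valid xs \<and> (\<exists>m. (m, 0) \<in> set xs) \<and> (\<forall>x\<in>set xs. fst x \<le> n)}"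

lemma ev_upto_cong:
  assumes "\<And>i. i \<le> n \<Longrightarrow> u i = w i"
  shows "ev_upto n u = ev_upto n w"
proof -
  have "comb u xs = comb w xs" if "\<forall>x\<in>set xs. fst x \<le> n" for xs
    using that assms by (induction xs) auto
  then show ?thesis unfolding ev_upto_def by (intro Collect_cong) metis
qed

lemma ev_upto_mono: "m \<le> n \<Longrightarrow> ev_upto m w \<subseteq> ev_upto n w"
  by (force simp: ev_upto_def)

lemma finite_ev_upto: "finite (ev_upto n w)"
proof -
  have "ev_upto n w \<subseteq> comb w ` {xs. set xs \<subseteq> {1..n} \<times> {..k n} \<and> distinct xs}"
  proof
    fix x assume "x \<in> ev_upto n w"
    then obtain xs where xs: "x = comb w xs" "valid xs" "\<forall>x\<in>set xs. fst x \<le> n"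
      by (auto simp: ev_upto_def)
    have "distinct xs"
      using xs(2) by (induction xs) auto
    moreover have "set xs \<subseteq> {1..n} \<times> {..k n}"
    proof
      fix y assume y: "y \<in> set xs"
      then have "1 \<le> fst y" "snd y \<le> k (fst y)" "fst y \<le> n"
        using validD[OF xs(2), of "fst y" "snd y"] xs(3) by auto
      then show "y \<in> {1..n} \<times> {..k n}" using k_le by (cases y) (auto intro: le_trans)
    qed
    ultimately show "x \<in> comb w ` {xs. set xs \<subseteq> {1..n} \<times> {..k n} \<and> distinct xs}"
      using xs(1) by blast
  qed
  then show ?thesis by (rule finite_subset) (intro finite_imageI finite_subset_distinct; simp)
qed

lemma ev_eq_Union: "ev w = (\<Union>n. ev_upto n w)"
proof (intro equalityI subsetI)
  fix x assume "x \<in> ev w"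
  then obtain xs m where xs: "x = comb w xs" "valid xs" "(m, 0) \<in> set xs" by (auto simp: ev_iff)
  then have "x \<in> ev_upto (Max (fst ` set xs)) w"
    unfolding ev_upto_def by (intro CollectI exI[of _ xs]) auto
  then show "x \<in> (\<Union>n. ev_upto n w)" by blast
qed (auto simp: ev_upto_def ev_iff)

text \<open>A finite sequence is filed under the last index it uses; stage 0 holds only the empty
  sequence. The clause on \<open>dom (w n)\<close> makes every word after \<open>s\<close> use
  indices above \<open>n\<close> only, which is what \<open>amalgamate\<close> exploits.\<close>

definition stage :: "nat \<Rightarrow> (nat \<Rightarrow> 'a word) \<Rightarrow> 'a word list set" where
  "stage n w = {s. set s \<subseteq> ev_upto n w \<and> sorted_wrt before s \<and>
    (n \<noteq> 0 \<longrightarrow> (\<exists>y\<in>set s. dom (w n) \<subseteq> dom y))}"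

lemma stage_cong: "(\<And>i. i \<le> n \<Longrightarrow> u i = w i) \<Longrightarrow> stage n u = stage n w"
  using ev_upto_cong[of n u w] by (simp add: stage_def)

lemma stage_evf: "w \<in> seqs \<Longrightarrow> stage n w \<subseteq> evf w"
  unfolding stage_def by (auto simp: evf_iff ev_eq_Union[of w] subset_iff)

lemma finite_stage:
  assumes "w \<in> seqs"
  shows "finite (stage n w)"
proof (rule finite_subset)
  show "stage n w \<subseteq> {s. set s \<subseteq> ev_upto n w \<and> distinct s}"
  proof
    fix s assume s: "s \<in> stage n w"
    have "dom x \<noteq> {}" if "x \<in> set s" for x
      using s that stage_evf[OF assms, of n] ev_words[OF assms] wordsD(2) evf_iff[OF assms] by blast
    moreover have "sorted_wrt before s" using s by (simp add: stage_def)
    ultimately have "distinct s"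
      by (induction s) (use before_irrefl in auto)
    with s show "s \<in> {s. set s \<subseteq> ev_upto n w \<and> distinct s}" by (simp add: stage_def)
  qed
qed (intro finite_subset_distinct finite_ev_upto)

lemma evf_stage:
  assumes w: "w \<in> seqs" and s: "s \<in> evf w"
  obtains n where "s \<in> stage n w"
proof -
  have "\<exists>n. set s \<subseteq> ev_upto n w"
  proof -
    have "\<exists>n. A \<subseteq> ev_upto n w" if "finite A" "A \<subseteq> (\<Union>n. ev_upto n w)" for A
      using that
    proof (induction A)
      case (insert x A)
      then obtain m n where "A \<subseteq> ev_upto m w" "x \<in> ev_upto n w" by auto
      then have "insert x A \<subseteq> ev_upto (max m n) w"
        using ev_upto_mono[of m "max m n" w] ev_upto_mono[of n "max m n" w] by auto
      then show ?case by blast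
    qed simp
    then show ?thesis using s by (simp add: evf_iff[OF w] ev_eq_Union)
  qed
  \<comment> \<open>If no entry used \<open>w n\<close> for this least \<open>n\<close>, then
    \<open>n - 1\<close> would do as well.\<close>
  define n where "n = (LEAST n. set s \<subseteq> ev_upto n w)"
  have n: "set s \<subseteq> ev_upto n w" unfolding n_def by (rule LeastI_ex) fact
  have least: "\<not> set s \<subseteq> ev_upto m w" if "m < n" for m
    using that not_less_Least unfolding n_def by blast
  have "\<exists>y\<in>set s. dom (w n) \<subseteq> dom y" if "n \<noteq> 0"
  proof -
    have "\<not> set s \<subseteq> ev_upto (n - 1) w" using that by (intro least) simp
    then obtain y where y: "y \<in> set s" "y \<notin> ev_upto (n - 1) w" by blast
    then have "y \<in> ev_upto n w" using n by blast
    then obtain xs where xs: "y = comb w xs" "valid xs" "\<exists>m. (m, 0) \<in> set xs" "\<forall>x\<in>set xs. fst x \<le> n"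
      unfolding ev_upto_def by blast
    have "\<not> (\<forall>x\<in>set xs. fst x \<le> n - 1)" using y(2) xs(1-3) unfolding ev_upto_def by blast
    then obtain x where x: "x \<in> set xs" "\<not> fst x \<le> n - 1" by blast
    moreover have "fst x \<le> n" using xs(4) x(1) by blast
    ultimately have "x \<in> set xs" "fst x = n" by auto
    then show ?thesis using y(1) by (intro bexI[of _ y]) (auto simp: xs(1) dom_comb)
  qed
  then have "s \<in> stage n w" using n s by (simp add: stage_def evf_iff[OF w])
  with that show thesis .
qed

text \<open>The first \<open>n\<close> terms of \<open>w\<close> have to be kept, since deleting them would shift the indices
  and thereby change the bounds \<open>p\<^sub>i \<le> k\<^sub>n\<close> on the substitutions.\<close>

lemma amalgamate:
  assumes w: "w \<in> seqs" and s: "s \<in> stage n w" and u: "ext u w"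
  obtains w' where "ext w' w" "\<And>i. i \<le> n \<Longrightarrow> w' i = w i" "after s w' \<subseteq> after s u"
proof -
  \<comment> \<open>All positions in \<open>u (i + c)\<close> are at least \<open>i + c\<close>, so
    for \<open>n \<ge> 1\<close> the shifted terms of \<open>u\<close> come after
    \<open>w n\<close>.\<close>
  define c where "c = Max (insert 0 (dom (w n)))"
  define w' where "w' i = (if i \<le> n then w i else u (i + c))" for i
  have u_seqs: "u \<in> seqs" using u by (rule ext_seqs)
  have join: "before (w n) (u (Suc n + c))" if "1 \<le> n"
  proof -
    have "finite (dom (w n))" using wordsD(1)[OF seqsD[OF w that]] .
    then have "i \<le> c" if "i \<in> dom (w n)" for i using that by (simp add: c_def)
    moreover have "Suc n + c \<le> j" if "j \<in> dom (u (Suc n + c))" for j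
      using seqs_dom_ge[OF u_seqs _ that] by simp
    ultimately show ?thesis by (fastforce simp: before_def)
  qed
  have "ext w' w"
  proof (rule extI[OF w])
    fix i :: nat assume i: "1 \<le> i"
    show "w' i \<in> ev w" using i ext_ev[OF u] nth_in_ev by (simp add: w'_def)
    show "before (w' i) (w' (Suc i))"
      using i join seqs_before[OF w] seqs_before[OF u_seqs]
      by (cases "i = n") (auto simp: w'_def)
  qed
  moreover have "after s w' \<subseteq> after s u"
  proof
    fix x assume x: "x \<in> after s w'"
    then obtain xs m where xs: "x = comb w' xs" "valid xs" "(m, 0) \<in> set xs"
      by (auto simp: after_def ev_iff)
    \<comment> \<open>No \<open>w i\<close> with \<open>1 \<le> i \<le> n\<close> can occur in
      \<open>x\<close>, since \<open>x\<close> comes after an entry of \<open>s\<close> that covers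
      \<open>w n\<close>.\<close>
    have gt: "n < fst z" if z: "z \<in> set xs" for z
    proof (rule ccontr)
      assume "\<not> n < fst z"
      moreover have "1 \<le> fst z" using validD[OF xs(2), of "fst z" "snd z"] z by simp
      ultimately have n: "n \<noteq> 0" "1 \<le> fst z" "fst z \<le> n" by auto
      then obtain y where y: "y \<in> set s" "dom (w n) \<subseteq> dom y" using s by (auto simp: stage_def)
      have "before y x" using x y(1) by (auto simp: after_def)
      moreover have "dom (w (fst z)) \<subseteq> dom x"
        using z n(3) unfolding xs(1) dom_comb by (auto simp: w'_def)
      ultimately have "before (w n) (w (fst z))" using y(2) unfolding before_def by blast
      then have "n < fst z" using before_index[OF w] n by simp
      with n show False by simp
    qed
    \<comment> \<open>The same word written over \<open>u\<close>. Indices only grow, so the bounds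
      on the substitutions persist.\<close>
    let ?ys = "map (\<lambda>(i, p). (i + c, p)) xs"
    have "\<forall>z\<in>set xs. n < fst z" using gt by blast
    then have "comb w' xs = comb u ?ys"
      by (induction xs) (auto simp: w'_def split: prod.splits)
    moreover have "p \<le> k (i + c)" if "(i, p) \<in> set xs" for i p
      using validD[OF xs(2) that] k_le[of i "i + c"] by simp
    then have "valid ?ys" using xs(2) by (fastforce simp: valid_def sorted_wrt_map split_def)
    moreover have "(m + c, 0) \<in> set ?ys" using xs(3) by force
    ultimately have "x \<in> ev u" unfolding ev_iff xs(1) by blast
    then show "x \<in> after s u" using x by (simp add: after_def)
  qed
  ultimately show thesis using that by (simp add: w'_def)
qed

text \<open>One amalgamation for each of the finitely many members of the stage; antimonotonicity
  preserves what was achieved for the earlier ones.\<close>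

lemma fusion_step:
  assumes w: "w \<in> seqs" "ext w w0" "w0 \<in> seqs"
    and anti: "\<And>s X Y. \<Phi> s Y \<Longrightarrow> X \<subseteq> Y \<Longrightarrow> \<Phi> s X"
    and dense: "\<And>s u. s \<in> evf w0 \<Longrightarrow> ext u w0 \<Longrightarrow> \<exists>u'. ext u' u \<and> \<Phi> s (after s u')"
  shows "\<exists>w'. ext w' w \<and> (\<forall>i\<le>n. w' i = w i) \<and> (\<forall>s\<in>stage n w. \<Phi> s (after s w'))"
proof -
  have "\<exists>w'. ext w' w \<and> (\<forall>i\<le>n. w' i = w i) \<and> (\<forall>s\<in>A. \<Phi> s (after s w'))"
    if "finite A" "A \<subseteq> stage n w" for A
    using that
  proof (induction A)
    case empty
    then show ?case using ext_refl[OF w(1)] by blast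
  next
    case (insert s A)
    then obtain w1 where w1: "ext w1 w" "\<forall>i\<le>n. w1 i = w i" "\<forall>s\<in>A. \<Phi> s (after s w1)" by blast
    note w1_seqs = ext_seqs[OF w1(1)]
    have s: "s \<in> stage n w1" using insert.prems stage_cong[of n w1 w] w1(2) by simp
    have "s \<in> evf w0" using insert.prems stage_evf[OF w(1)] evf_ext[OF w(2,3)] by blast
    moreover have "ext w1 w0" using ext_trans w w1(1) by blast
    ultimately obtain u where u: "ext u w1" "\<Phi> s (after s u)" using dense by blast
    obtain w2 where w2: "ext w2 w1" "\<And>i. i \<le> n \<Longrightarrow> w2 i = w1 i" "after s w2 \<subseteq> after s u"
      using amalgamate[OF w1_seqs s u(1)] by metis
    have "\<Phi> t (after t w2)" if "t \<in> insert s A" for t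
      using that anti[OF u(2) w2(3)] w1(3) after_ext[OF w2(1) w1_seqs] anti by blast
    moreover have "ext w2 w" using ext_trans w2(1) w1(1) w(1) by blast
    ultimately show ?case using w2(2) w1(2) by auto
  qed
  from this[OF finite_stage[OF w(1)] order_refl] show ?thesis .
qed

text \<open>\<open>V n\<close> agrees up to index \<open>n\<close> with all later
  \<open>V m\<close>, so the diagonal sequence extracts from every \<open>V n\<close>. A sequence of
  stage \<open>n\<close> over the diagonal was already settled in the passage to
  \<open>V (Suc n)\<close>.\<close>

lemma fusion:
  assumes w: "w \<in> seqs"
    and anti: "\<And>s X Y. \<Phi> s Y \<Longrightarrow> X \<subseteq> Y \<Longrightarrow> \<Phi> s X"
    and dense: "\<And>s u. s \<in> evf w \<Longrightarrow> ext u w \<Longrightarrow> \<exists>u'. ext u' u \<and> \<Phi> s (after s u')"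
  obtains u where "ext u w" "\<And>s. s \<in> evf u \<Longrightarrow> \<Phi> s (after s u)"
proof -
  have "\<exists>V. \<forall>n. ext (V n) w \<and> (ext (V (Suc n)) (V n) \<and> (\<forall>i\<le>n. V (Suc n) i = V n i) \<and>
      (\<forall>s\<in>stage n (V n). \<Phi> s (after s (V (Suc n)))))"
  proof (rule dependent_nat_choice)
    show "\<exists>u. ext u w" using ext_refl[OF w] by blast
    fix u n assume u: "ext u w"
    have "\<exists>u'. ext u' u \<and> (\<forall>i\<le>n. u' i = u i) \<and> (\<forall>s\<in>stage n u. \<Phi> s (after s u'))"
      by (rule fusion_step[OF ext_seqs[OF u] u w]) (fact anti, fact dense)
    then show "\<exists>y. ext y w \<and> ext y u \<and> (\<forall>i\<le>n. y i = u i) \<and> (\<forall>s\<in>stage n u. \<Phi> s (after s y))"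
      using ext_trans[OF _ u w] by blast
  qed
  then obtain V where V: "\<And>n. ext (V n) w" "\<And>n. ext (V (Suc n)) (V n)"
    "\<And>n i. i \<le> n \<Longrightarrow> V (Suc n) i = V n i"
    "\<And>n s. s \<in> stage n (V n) \<Longrightarrow> \<Phi> s (after s (V (Suc n)))"
    by blast
  note V_seqs = ext_seqs[OF V(1)]
  have V_ext: "ext (V n) (V m)" if "m \<le> n" for m n
    using that by (induction n rule: dec_induct) (use ext_refl V_seqs V(2) ext_trans in blast)+
  define u where "u i = V i i" for i
  have V_eq: "V n i = u i" if "i \<le> n" for i n
    using that by (induction n rule: dec_induct) (simp_all add: u_def V(3))
  have ext_V: "ext u (V n)" for n
  proof (rule extI[OF V_seqs])
    fix j :: nat assume j: "1 \<le> j"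
    have "V (max j n) j \<in> ev (V n)" using ext_ev[OF V_ext[of n "max j n"] j] by simp
    then show "u j \<in> ev (V n)" by (simp add: V_eq)
    have "before (V (Suc j) j) (V (Suc j) (Suc j))" using j by (intro seqs_before[OF V_seqs]) auto
    then show "before (u j) (u (Suc j))" by (simp add: V_eq)
  qed
  note u_seqs = ext_seqs[OF ext_V[of 0]]
  show thesis
  proof
    show "ext u w" using ext_trans[OF ext_V[of 0] V(1) w] .
    fix s assume "s \<in> evf u"
    then obtain n where "s \<in> stage n u" using evf_stage[OF u_seqs] by blast
    then have "s \<in> stage n (V n)" using stage_cong[of n "V n" u] V_eq by simp
    then show "\<Phi> s (after s u)" by (rule anti[OF V(4) after_ext[OF ext_V V_seqs]])
  qed
qed

section \<open>Combinatorial forcing\<close>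

definition hits :: "'a word list set \<Rightarrow> 'a word list \<Rightarrow> (nat \<Rightarrow> 'a word) \<Rightarrow> bool" where
  "hits F s t \<longleftrightarrow> (\<exists>m. take m s \<in> F) \<or> (\<exists>m. s @ map t [1..<Suc m] \<in> F)"

text \<open>A predicate of a set of words, later \<open>after s u\<close>, and not of the sequence
  \<open>u\<close>: this makes it antimonotone under inclusion, as \<open>fusion\<close> demands.
  The same holds for \<open>rejects\<close>.\<close>

definition accepts :: "'a word list set \<Rightarrow> 'a word list \<Rightarrow> 'a word set \<Rightarrow> bool" where
  "accepts F s X \<longleftrightarrow> (\<forall>t\<in>seqs. (\<forall>n\<ge>1. t n \<in> X) \<longrightarrow> hits F s t)"

definition rejects :: "'a word list set \<Rightarrow> 'a word list \<Rightarrow> 'a word set \<Rightarrow> bool" where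
  "rejects F s X \<longleftrightarrow> (\<forall>t\<in>seqs. (\<forall>n\<ge>1. t n \<in> X) \<longrightarrow> \<not> accepts F s (after s t))"

lemma acceptsD: "accepts F s X \<Longrightarrow> t \<in> seqs \<Longrightarrow> (\<And>n. 1 \<le> n \<Longrightarrow> t n \<in> X) \<Longrightarrow> hits F s t"
  by (simp add: accepts_def)

lemma rejectsD:
  "rejects F s X \<Longrightarrow> t \<in> seqs \<Longrightarrow> (\<And>n. 1 \<le> n \<Longrightarrow> t n \<in> X) \<Longrightarrow> \<not> accepts F s (after s t)"
  by (simp add: rejects_def)

lemma accepts_antimono:
  assumes "accepts F s Y" "X \<subseteq> Y"
  shows "accepts F s X"
  unfolding accepts_def using assms(2) by (intro ballI impI acceptsD[OF assms(1)]) auto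

lemma rejects_antimono:
  assumes "rejects F s Y" "X \<subseteq> Y"
  shows "rejects F s X"
  unfolding rejects_def using assms(2) by (intro ballI impI rejectsD[OF assms(1)]) auto

lemma hits_snoc:
  assumes "hits F (s @ [t 1]) (\<lambda>n. t (n + 1))"
  shows "hits F s t"
proof -
  have upt: "map (\<lambda>n. t (n + 1)) [1..<Suc m] = map t [2..<Suc (Suc m)]" for m
    using map_Suc_upt[of 1 "Suc m"] map_map[of t Suc "[1..<Suc m]"]
    by (simp add: comp_def numeral_2_eq_2 del: upt_Suc)
  have "(s @ [t 1]) @ map (\<lambda>n. t (n + 1)) [1..<Suc m] = s @ map t [1..<Suc (Suc m)]" for m
    using upt_conv_Cons[of 1 "Suc (Suc m)"] unfolding upt by (simp add: numeral_2_eq_2 del: upt_Suc)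
  moreover have "take m (s @ [t 1]) = take m s \<or> take m (s @ [t 1]) = s @ map t [1..<Suc 1]" for m
    by (cases "m - length s") auto
  ultimately show ?thesis using assms unfolding hits_def by metis
qed

text \<open>A sequence witnessing that \<open>s\<close> is not rejected is itself an extraction that
  accepts \<open>s\<close>.\<close>

lemma decide:
  assumes "u \<in> seqs" "set s \<subseteq> words"
  shows "\<exists>u'. ext u' u \<and> (accepts F s (after s u') \<or> rejects F s (after s u'))"
proof (cases "rejects F s (after s u)")
  case True
  then show ?thesis using ext_refl[OF assms(1)] by blast
next
  case False
  then obtain t where "t \<in> seqs" "\<forall>n\<ge>1. t n \<in> after s u" "accepts F s (after s t)"
    unfolding rejects_def by blast
  then show ?thesis by (auto simp: after_def extraction_def)
qed

text \<open>The pigeonhole principle is applied to the set of those \<open>x\<close> for which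
  \<open>s @ [x]\<close> is accepted. If it contained all of \<open>ev w'\<close>, a shift of
  \<open>w'\<close> would accept \<open>s\<close>. So it misses \<open>ev w'\<close>, and
  \<open>decided\<close> turns non-acceptance into rejection. Rejection refers to the fixed
  \<open>u\<close>, so that the conclusion is antimonotone in \<open>after s w'\<close> and can be
  fused.\<close>

lemma rejects_snoc:
  assumes u: "u \<in> seqs" and decided: "\<And>s. s \<in> evf u \<Longrightarrow> accepts F s (after s u) \<or> rejects F s (after s u)"
    and s: "s \<in> evf u" "rejects F s (after s u)" and w: "ext w u"
  shows "\<exists>w'. ext w' w \<and> (\<forall>x\<in>after s w'. rejects F (s @ [x]) (after (s @ [x]) u))"
proof -
  obtain w' where w': "ext w' w" and
    or: "ev w' \<subseteq> {x. accepts F (s @ [x]) (after (s @ [x]) u)} \<or>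
         ev w' \<inter> {x. accepts F (s @ [x]) (after (s @ [x]) u)} = {}"
    by (rule pigeonhole[OF ext_seqs[OF w]])
  have w'u: "ext w' u" using ext_trans[OF w' w u] .
  note w'_seqs = ext_seqs[OF w']
  have s_words: "set s \<subseteq> words" using s(1) ev_words[OF u] evf_iff[OF u] by blast
  have "\<not> ev w' \<subseteq> {x. accepts F (s @ [x]) (after (s @ [x]) u)}"
  proof
    assume acc: "ev w' \<subseteq> {x. accepts F (s @ [x]) (after (s @ [x]) u)}"
    obtain c where c: "\<And>n. 1 \<le> n \<Longrightarrow> w' (n + c) \<in> after s w'"
      using shift_after[OF w'_seqs s_words] by metis
    let ?t = "\<lambda>n. w' (n + c)"
    have t: "ext ?t w'" by (rule shift_ext[OF w'_seqs])
    have "accepts F s (after s ?t)"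
      unfolding accepts_def
    proof (intro ballI impI)
      fix t' assume t': "t' \<in> seqs" "\<forall>n\<ge>1. t' n \<in> after s ?t"
      have in_w': "t' n \<in> after s w'" if "1 \<le> n" for n
        using t'(2) that after_ext[OF t w'_seqs] by blast
      then have "accepts F (s @ [t' 1]) (after (s @ [t' 1]) u)" using acc by (auto simp: after_def)
      note * = acceptsD[OF this shift_seqs[OF t'(1)]]
      have "t' (n + 1) \<in> after (s @ [t' 1]) u" if "1 \<le> n" for n
        using in_w'[of "n + 1"] after_ext[OF w'u u, of s] seqs_before[OF t'(1), of 1 "n + 1"] that
        by (auto simp: after_def)
      then have "hits F (s @ [t' 1]) (\<lambda>n. t' (n + 1))"
        by (intro *)
      then show "hits F s t'" by (rule hits_snoc)
    qed
    moreover have "?t n \<in> after s u" if "1 \<le> n" for n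
      using c[OF that] after_ext[OF w'u u] by blast
    ultimately show False using rejectsD[OF s(2) ext_seqs[OF t]] by blast
  qed
  with or have nacc: "\<not> accepts F (s @ [x]) (after (s @ [x]) u)" if "x \<in> ev w'" for x
    using that by blast
  have "rejects F (s @ [x]) (after (s @ [x]) u)" if x: "x \<in> after s w'" for x
  proof -
    have "s @ [x] \<in> evf u"
      using s(1) x ev_ext[OF w'u u] by (auto simp: evf_iff[OF u] after_def sorted_wrt_append)
    moreover have "x \<in> ev w'" using x by (simp add: after_def)
    ultimately show ?thesis using decided nacc by blast
  qed
  with w' show ?thesis by blast
qed

lemma nash_williams:
  assumes w: "w \<in> seqs"
  obtains u where "ext u w" "evf u \<inter> F = {} \<or>
    (\<forall>t\<in>seqs. (\<forall>n\<ge>1. t n \<in> ev u) \<longrightarrow> (\<exists>m. map t [1..<Suc m] \<in> F))"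
proof -
  obtain u where u: "ext u w"
    and decided: "\<And>s. s \<in> evf u \<Longrightarrow> accepts F s (after s u) \<or> rejects F s (after s u)"
  proof (rule fusion[OF w, where \<Phi> = "\<lambda>s X. accepts F s X \<or> rejects F s X"])
    fix s u assume "s \<in> evf w" "ext u w"
    then show "\<exists>u'. ext u' u \<and> (accepts F s (after s u') \<or> rejects F s (after s u'))"
      using ev_words[OF w] evf_iff[OF w] by (intro decide ext_seqs) auto
  qed (use accepts_antimono rejects_antimono in blast)+
  note u_seqs = ext_seqs[OF u]
  have empty: "[] \<in> evf u" by (simp add: evf_iff[OF u_seqs])
  show thesis
  proof (cases "accepts F [] (after [] u)")
    case True
    then have "\<exists>m. map t [1..<Suc m] \<in> F" if "t \<in> seqs" "\<forall>n\<ge>1. t n \<in> ev u" for t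
    proof -
      have "hits F [] t" using True that by (simp add: accepts_def after_def)
      \<comment> \<open>Covers the alternative \<open>take m [] \<in> F\<close> of
        \<open>hits\<close>: the empty list is the initial segment of \<open>t\<close> of length
        0.\<close>
      moreover have "[] = map t [1..<Suc 0]" by simp
      ultimately show ?thesis unfolding hits_def by (metis append_Nil take_Nil)
    qed
    with u that show thesis by blast
  next
    case False
    then have rej: "rejects F [] (after [] u)" using decided empty by blast
    \<comment> \<open>The second fusion: below \<open>u'\<close>, rejection is inherited by one-term
      extensions, and thus by all finite sequences starting from the empty one.\<close>
    obtain u' where u': "ext u' u" and ext_rej: "\<And>s. s \<in> evf u' \<Longrightarrow> s \<in> evf u \<and> rejects F s (after s u) \<longrightarrow>
        (\<forall>x\<in>after s u'. rejects F (s @ [x]) (after (s @ [x]) u))"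
    proof (rule fusion[OF u_seqs, where \<Phi> = "\<lambda>s X. s \<in> evf u \<and> rejects F s (after s u) \<longrightarrow>
        (\<forall>x\<in>X. rejects F (s @ [x]) (after (s @ [x]) u))"])
      fix s w' assume "s \<in> evf u" "ext w' u"
      then show "\<exists>u'. ext u' w' \<and> (s \<in> evf u \<and> rejects F s (after s u) \<longrightarrow>
          (\<forall>x\<in>after s u'. rejects F (s @ [x]) (after (s @ [x]) u)))"
        using rejects_snoc[OF u_seqs decided] ext_refl[OF ext_seqs] by blast
    qed blast+
    note u'_seqs = ext_seqs[OF u']
    have all_rej: "rejects F s (after s u)" if "s \<in> evf u'" for s
      using that
    proof (induction s rule: rev_induct)
      case (snoc x s)
      then have s: "s \<in> evf u'" "x \<in> after s u'"
        by (auto simp: evf_iff[OF u'_seqs] sorted_wrt_append after_def)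
      then show ?case using snoc.IH ext_rej evf_ext[OF u' u_seqs] by blast
    qed (rule rej)
    have "s \<notin> F" if s: "s \<in> evf u'" for s
    proof
      assume "s \<in> F"
      \<comment> \<open>A member of \<open>F\<close> is its own initial segment, so every set
        accepts it; this is incompatible with rejection.\<close>
      then have "hits F s t" for t unfolding hits_def by (metis order_refl take_all)
      then have acc: "accepts F s X" for X by (simp add: accepts_def)
      have "set s \<subseteq> words" using s ev_words[OF u'_seqs] evf_iff[OF u'_seqs] by blast
      then obtain c where "\<And>n. 1 \<le> n \<Longrightarrow> u (n + c) \<in> after s u"
        using shift_after[OF u_seqs] by metis
      then show False
        using rejectsD[OF all_rej[OF s] shift_seqs[OF u_seqs]] acc by blast
    qed
    then show thesis using that ext_trans[OF u' u w] by blast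
  qed
qed

end

section \<open>Cantor normal forms\<close>

lemma not_less_0_cord: "\<not> x < (0::cord)"
  using zero_le_cord by (simp add: not_less)

lemma zero_less_cord_iff: "(0::cord) < x \<longleftrightarrow> x \<noteq> 0"
  using zero_le_cord[of x] by auto

lemma osuc_neq_0: "osuc x \<noteq> 0"
  using less_osuc[of x] not_less_0_cord by metis

lemma not_is_limit_osuc: "\<not> is_limit (osuc x)"
  by (auto simp: is_limit_def is_succ_def)

lemma osuc_less_limit: "is_limit y \<Longrightarrow> x < y \<Longrightarrow> osuc x < y"
  by (metis not_is_limit_osuc osuc_le_iff order_le_less)

lemma cord_cases [case_names zero succ limit]:
  obtains "x = (0::cord)" | y where "x = osuc y" | "is_limit x"
  by (auto simp: is_limit_def is_succ_def)

lemma orec_le_limit: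
  assumes "is_limit y" "x < y"
  shows "orec z f x \<le> orec z f y"
proof -
  have "countable {..<y}" by (rule countable_subset[OF _ countable_atMost_cord[of y]]) auto
  then show ?thesis
    unfolding orec_limit[OF assms(1)] using assms(2)
    by (intro cSUP_upper bdd_above_countable_cord) auto
qed

text \<open>Growth of \<open>f\<close> is required only from \<open>z\<close> on, because in the
  recursion for powers \<open>x < x * \<omega>\<close> fails at 0. The bound
  \<open>z \<le> orec z f y\<close> is carried along to stay in that range.\<close>

lemma orec_strict_mono_aux:
  assumes f: "\<And>x. z \<le> x \<Longrightarrow> x < f x"
  shows "z \<le> orec z f y \<and> (\<forall>x<y. orec z f x < orec z f y)"
proof (induction y rule: less_induct)
  case (less y)
  show ?case
  proof (cases y rule: cord_cases)
    case zero
    then show ?thesis by (simp add: orec_0 not_less_0_cord)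
  next
    case (succ y')
    then have IH: "z \<le> orec z f y'" "\<And>x. x < y' \<Longrightarrow> orec z f x < orec z f y'"
      using less.IH[of y'] less_osuc by auto
    have step: "orec z f y' < orec z f y" using f[OF IH(1)] by (simp add: succ orec_osuc)
    moreover have "orec z f x < orec z f y" if "x < y" for x
    proof (cases "x = y'")
      case False
      then have "x < y'" using that by (simp add: succ less_osuc_iff)
      then have "orec z f x < orec z f y'" by (rule IH(2))
      then show ?thesis using step by (rule less_trans)
    qed (use step in simp)
    ultimately show ?thesis using IH(1) by auto
  next
    case limit
    have "orec z f x < orec z f y" if x: "x < y" for x
    proof -
      have "orec z f x < orec z f (osuc x)"
        using less.IH[OF osuc_less_limit[OF limit x]] less_osuc by blast
      also have "\<dots> \<le> orec z f y" using limit osuc_less_limit[OF limit x] by (rule orec_le_limit)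
      finally show ?thesis .
    qed
    moreover have "0 < y" using limit by (simp add: is_limit_def zero_less_cord_iff)
    ultimately show ?thesis using orec_0[of z f] by (metis less_imp_le)
  qed
qed

lemma orec_ge: "(\<And>x. z \<le> x \<Longrightarrow> x < f x) \<Longrightarrow> z \<le> orec z f y"
  using orec_strict_mono_aux[of z f] by blast

lemma orec_strict_mono: "(\<And>x. z \<le> x \<Longrightarrow> x < f x) \<Longrightarrow> x < y \<Longrightarrow> orec z f x < orec z f y"
  using orec_strict_mono_aux[of z f] by blast

text \<open>If the value were \<open>osuc m\<close>, a supremum, some earlier value would exceed
  \<open>m\<close> and so reach \<open>osuc m\<close>, against strict growth.\<close>

lemma is_limit_orec:
  assumes f: "\<And>x. z \<le> x \<Longrightarrow> x < f x" and y: "is_limit y"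
  shows "is_limit (orec z f y)"
proof (cases "orec z f y" rule: cord_cases)
  case zero
  have "0 < y" using y by (simp add: is_limit_def zero_less_cord_iff)
  then have "orec z f 0 < orec z f y" by (intro orec_strict_mono f)
  then show ?thesis using zero not_less_0_cord by simp
next
  case (succ m)
  then have "m < (SUP x\<in>{..<y}. orec z f x)" using orec_limit[OF y] less_osuc by metis
  moreover have "0 \<in> {..<y}" using y by (simp add: is_limit_def zero_less_cord_iff)
  then have "{..<y} \<noteq> {}" by blast
  ultimately obtain x where x: "x < y" "m < orec z f x"
    by (metis cSUP_least lessThan_iff not_le)
  have "orec z f x < orec z f y" using x(1) by (intro orec_strict_mono f)
  with x(2) show ?thesis by (metis succ less_osuc_iff not_le)
qed

lemma strict_mono_cord_ge:
  fixes g :: "cord \<Rightarrow> cord"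
  assumes "\<And>x y. x < y \<Longrightarrow> g x < g y"
  shows "y \<le> g y"
proof (induction y rule: less_induct)
  case (less y)
  then show ?case using assms[of "g y" y] by (meson not_le)
qed

lemma plus_cord_strict_mono: "(y::cord) < z \<Longrightarrow> x + y < x + z"
  unfolding plus_cord_def by (rule orec_strict_mono) (rule less_osuc)

lemma less_plus_cord: "0 < y \<Longrightarrow> x < x + (y::cord)"
  using plus_cord_strict_mono[of 0 y x] by (simp add: plus_cord_rec)

lemma le_plus_cord_left: "(x::cord) \<le> x + y"
  using less_plus_cord[of y x] by (cases "y = 0") (auto simp: plus_cord_rec zero_less_cord_iff)

lemma le_plus_cord_right: "(y::cord) \<le> x + y"
  by (rule strict_mono_cord_ge) (rule plus_cord_strict_mono)

lemma times_cord_strict_mono: "0 < x \<Longrightarrow> (y::cord) < z \<Longrightarrow> x * y < x * z"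
  unfolding times_cord_def by (rule orec_strict_mono) (rule less_plus_cord)

lemma is_limit_times: "0 < x \<Longrightarrow> is_limit y \<Longrightarrow> is_limit (x * y)"
  unfolding times_cord_def by (rule is_limit_orec) (rule less_plus_cord)

lemma ofin_simps [simp]: "ofin 0 = 0" "ofin (Suc n) = osuc (ofin n)"
  by (simp_all add: ofin_def)

lemma ofin_strict_mono: "m < n \<Longrightarrow> ofin m < ofin n"
  by (rule lift_Suc_mono_less[of ofin]) (simp_all add: less_osuc)

lemma ofin_less_oomega: "ofin n < oomega"
proof -
  have "ofin (Suc n) \<le> oomega"
    unfolding oomega_def by (intro cSUP_upper bdd_above_countable_cord) auto
  then show ?thesis using ofin_strict_mono[of n "Suc n"] by simp
qed

lemma is_limit_oomega: "is_limit oomega"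
proof (cases oomega rule: cord_cases)
  case zero
  then show ?thesis using ofin_less_oomega[of 0] by simp
next
  case (succ m)
  then have "m < (SUP n. ofin n)" using less_osuc unfolding oomega_def by metis
  then obtain n where "m < ofin n" by (metis UNIV_not_empty cSUP_least not_le)
  then have "oomega \<le> ofin n" by (simp add: succ osuc_le_iff)
  then show ?thesis using ofin_less_oomega[of n] by simp
qed

lemma le_times_ofin:
  assumes "1 \<le> p"
  shows "x \<le> x * ofin p"
proof (cases p)
  case (Suc q)
  then show ?thesis using le_plus_cord_right by (simp add: times_cord_rec)
qed (use assms in simp)

lemma less_times_oomega:
  assumes "1 \<le> z"
  shows "z < z * oomega"
proof -
  have z: "0 < z" using assms less_osuc[of 0] by (simp add: one_cord_def)
  have "z \<le> z * ofin 1" by (rule le_times_ofin) simp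
  also have "\<dots> < z * oomega" using z ofin_less_oomega by (rule times_cord_strict_mono)
  finally show ?thesis .
qed

lemma omega_exp_pos: "0 < omega_exp a"
proof -
  have "1 \<le> omega_exp a" unfolding oexp_def by (rule orec_ge) (rule less_times_oomega)
  then show ?thesis using less_osuc[of 0] by (simp add: one_cord_def)
qed

lemma omega_exp_strict_mono: "a < b \<Longrightarrow> omega_exp a < omega_exp b"
  unfolding oexp_def by (rule orec_strict_mono) (rule less_times_oomega)

lemma omega_exp_less_iff: "omega_exp a < omega_exp b \<longleftrightarrow> a < b"
  using omega_exp_strict_mono by (metis less_asym linorder_neqE)

lemma omega_exp_eq_iff: "omega_exp a = omega_exp b \<longleftrightarrow> a = b"
  using omega_exp_strict_mono by (metis less_irrefl linorder_neqE)

lemma is_limit_omega_exp: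
  assumes "b \<noteq> 0"
  shows "is_limit (omega_exp b)"
proof (cases b rule: cord_cases)
  case (succ c)
  then show ?thesis using is_limit_times omega_exp_pos is_limit_oomega by (simp add: oexp_rec)
next
  case limit
  then show ?thesis unfolding oexp_def by (intro is_limit_orec less_times_oomega)
qed (use assms in simp)

section \<open>Finite sums of powers of \<omega>\<close>

lemma omega_sum_simps [simp]:
  "omega_sum [] = 0" "omega_sum ((a, p) # cs) = omega_exp a * ofin p + omega_sum cs"
  by (simp_all add: omega_sum_def)

lemma omega_term_less:
  assumes "r < omega_exp a"
  shows "omega_exp a * ofin p + r < omega_exp a * ofin (Suc p)"
  using plus_cord_strict_mono[OF assms] by (simp add: times_cord_rec)

lemma omega_term_less_exp:
  assumes "r < omega_exp a" "a < b"
  shows "omega_exp a * ofin p + r < omega_exp b"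
proof -
  note omega_term_less[OF assms(1)]
  also have "omega_exp a * ofin (Suc p) < omega_exp a * oomega"
    using omega_exp_pos ofin_less_oomega by (rule times_cord_strict_mono)
  also have "omega_exp a * oomega = omega_exp (osuc a)" by (simp add: oexp_rec)
  also have "\<dots> \<le> omega_exp b"
    using assms(2) omega_exp_strict_mono osuc_le_iff by (metis order_le_less)
  finally show ?thesis .
qed

lemma omega_sum_less:
  assumes "sorted_wrt (\<lambda>c d. fst c > fst d) cs" "\<forall>c\<in>set cs. fst c < b"
  shows "omega_sum cs < omega_exp b"
  using assms
proof (induction cs arbitrary: b)
  case (Cons c cs)
  then show ?case using omega_term_less_exp[of "omega_sum cs" "fst c" b "snd c"] by (cases c) auto
qed (simp add: omega_exp_pos)

lemma omega_exp_le_term: "1 \<le> p \<Longrightarrow> omega_exp a \<le> omega_exp a * ofin p + r"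
  using le_times_ofin le_plus_cord_left by (rule order_trans)

text \<open>The remainder is smaller than the leading power, so the sum is at least \<omega>^a p and
  less than \<omega>^a (p + 1). This determines first \<open>a\<close>, then \<open>p\<close>;
  strict monotonicity of addition in the right summand cancels the leading term.\<close>

lemma omega_sum_inject:
  assumes "sorted_wrt (\<lambda>c d. fst c > fst d) cs" "\<forall>c\<in>set cs. 1 \<le> snd c"
    and "sorted_wrt (\<lambda>c d. fst c > fst d) ds" "\<forall>c\<in>set ds. 1 \<le> snd c"
    and "omega_sum cs = omega_sum ds"
  shows "cs = ds"
  using assms
proof (induction cs arbitrary: ds)
  case Nil
  show ?case
  proof (cases ds)
    case (Cons d ds')
    then show ?thesis
      using Nil omega_exp_le_term[of "snd d" "fst d" "omega_sum ds'"] omega_exp_pos[of "fst d"]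
      by (cases d) auto
  qed simp
next
  case (Cons c cs)
  obtain a p where c: "c = (a, p)" by force
  have rest: "omega_sum cs < omega_exp a" using Cons.prems by (intro omega_sum_less) (auto simp: c)
  show ?case
  proof (cases ds)
    case Nil
    then show ?thesis
      using Cons.prems omega_exp_le_term[of p a "omega_sum cs"] omega_exp_pos[of a] by (auto simp: c)
  next
    case ds: (Cons d ds')
    obtain b q where d: "d = (b, q)" by force
    have rest': "omega_sum ds' < omega_exp b"
      using Cons.prems by (intro omega_sum_less) (auto simp: ds d)
    have eq: "omega_exp a * ofin p + omega_sum cs = omega_exp b * ofin q + omega_sum ds'"
      using Cons.prems by (simp add: c ds d)
    have pq: "1 \<le> p" "1 \<le> q" using Cons.prems by (auto simp: c ds d)
    have ab: "a = b"
      using omega_term_less_exp[OF rest, of b p] omega_term_less_exp[OF rest', of a q]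
        omega_exp_le_term[OF pq(1), of a "omega_sum cs"] omega_exp_le_term[OF pq(2), of b "omega_sum ds'"]
      unfolding eq by (metis leD linorder_neqE)
    have le: "omega_exp a * ofin (Suc m) \<le> omega_exp a * ofin n + r" if "m < n" for m n r
    proof -
      have "ofin (Suc m) \<le> ofin n" using ofin_strict_mono[of "Suc m" n] that by (cases "Suc m = n") auto
      then have "omega_exp a * ofin (Suc m) \<le> omega_exp a * ofin n"
        using times_cord_strict_mono[OF omega_exp_pos] by (metis order_le_less)
      then show ?thesis using le_plus_cord_left order_trans by blast
    qed
    have "p = q"
      using omega_term_less[OF rest, of p] omega_term_less[OF rest', of q] le[of p q "omega_sum ds'"]
        le[of q p "omega_sum cs"]
      unfolding eq ab[symmetric] by (metis leD linorder_neqE)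
    moreover from this have "omega_sum cs = omega_sum ds'"
      using eq plus_cord_strict_mono unfolding ab by (metis less_irrefl linorder_neqE)
    then have "cs = ds'" using Cons.prems by (intro Cons.IH) (auto simp: ds)
    ultimately show ?thesis by (simp add: c d ds ab)
  qed
qed

section \<open>Schreier families are thin\<close>

definition initial :: "nat set \<Rightarrow> nat set \<Rightarrow> bool" where
  "initial s t \<longleftrightarrow> s \<subseteq> t \<and> (\<forall>x\<in>s. \<forall>y\<in>t. y < x \<longrightarrow> y \<in> s)"

text \<open>Symmetric, because the induction descends to blocks, and the first block of an initial
  segment may a priori be shorter or longer than that of the larger set.\<close>

definition comparable :: "nat set \<Rightarrow> nat set \<Rightarrow> bool" where
  "comparable s t \<longleftrightarrow> initial s t \<or> initial t s"

lemma initial_trans: "initial s t \<Longrightarrow> initial t u \<Longrightarrow> initial s u"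
  unfolding initial_def by blast

lemma initial_initial_comparable:
  assumes "initial s u" "initial t u"
  shows "comparable s t"
proof (cases "s \<subseteq> t")
  case True
  then show ?thesis using assms by (auto simp: comparable_def initial_def)
next
  case False
  then obtain a where a: "a \<in> s" "a \<notin> t" by blast
  have "t \<subseteq> s"
  proof
    fix b assume b: "b \<in> t"
    then consider "b < a" | "b = a" | "a < b" by linarith
    then show "b \<in> s" using assms a b unfolding initial_def by cases blast+
  qed
  then show ?thesis using assms by (auto simp: comparable_def initial_def)
qed

lemma set_lessD: "set_less s t \<Longrightarrow> finite s \<Longrightarrow> finite t \<Longrightarrow> a \<in> s \<Longrightarrow> b \<in> t \<Longrightarrow> a < b"
  unfolding set_less_def by (meson Max_ge Min_le le_less_trans less_le_trans)

lemma comparable_Min: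
  assumes "comparable s t" "finite s" "finite t" "s \<noteq> {}" "t \<noteq> {}"
  shows "Min s = Min t"
proof -
  have "Min s = Min t" if "initial s t" "finite s" "finite t" "s \<noteq> {}" "t \<noteq> {}" for s t
    using that unfolding initial_def by (metis Min_in Min_le linorder_neqE_nat not_less subsetD)
  then show ?thesis using assms unfolding comparable_def by metis
qed

text \<open>Both first blocks are initial segments of the larger union, hence comparable and so
  equal; removing them leaves comparable unions. The two lists have equal length by
  \<open>list_all2\<close>, which the cases of \<open>in_schreier_thin\<close> must establish
  separately.\<close>

lemma comparable_blocks:
  assumes "list_all2 (\<lambda>s t. comparable s t \<longrightarrow> s = t) xs ys"
    and "sorted_wrt set_less xs" "sorted_wrt set_less ys"
    and "\<forall>s\<in>set xs \<union> set ys. finite s"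
    and "comparable (\<Union>(set xs)) (\<Union>(set ys))"
  shows "xs = ys"
  using assms
proof (induction rule: list_all2_induct)
  case (Cons x xs y ys)
  have less: "a < b" if "t \<in> set xs" "a \<in> x" "b \<in> t" for a b t
    using Cons.prems(1,3) that by (intro set_lessD[of x t]) auto
  have less': "a < b" if "t \<in> set ys" "a \<in> y" "b \<in> t" for a b t
    using Cons.prems(2,3) that by (intro set_lessD[of y t]) auto
  let ?U = "\<Union>(set (x # xs))" and ?V = "\<Union>(set (y # ys))"
  have "initial x ?U" "initial y ?V"
    using less less' unfolding initial_def by (auto; meson less_asym)+
  then have "comparable x y"
    using Cons.prems(4) initial_trans initial_initial_comparable unfolding comparable_def by metis
  then have eq: "x = y" using Cons.hyps by simp
  have "x \<inter> \<Union>(set xs) = {}" "x \<inter> \<Union>(set ys) = {}" using less less' eq by fastforce+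
  then have "comparable (\<Union>(set xs)) (\<Union>(set ys))"
    using Cons.prems(4) unfolding eq comparable_def initial_def by (simp add: Int_Un_distrib) blast
  then show ?case using Cons eq by simp
qed simp

text \<open>Two predicates are allowed because the blocks of \<open>s\<close> will come with the
  induction hypothesis attached, those of \<open>t\<close> without it.\<close>

lemma block_union_comparable:
  assumes "block_union A p s" "block_union B p t" "comparable s t"
    and eq: "\<And>a b. A a \<Longrightarrow> B b \<Longrightarrow> comparable a b \<Longrightarrow> a = b"
    and fin: "\<And>a. A a \<Longrightarrow> finite a" "\<And>a. B a \<Longrightarrow> finite a"
  shows "s = t"
proof -
  obtain xs where xs: "length xs = p" "sorted_wrt set_less xs" "\<forall>x\<in>set xs. A x" "s = \<Union>(set xs)"
    using assms(1) by (auto simp: block_union_def)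
  obtain ys where ys: "length ys = p" "sorted_wrt set_less ys" "\<forall>x\<in>set ys. B x" "t = \<Union>(set ys)"
    using assms(2) by (auto simp: block_union_def)
  have "xs ! i = ys ! i" if "i < p" "comparable (xs ! i) (ys ! i)" for i
    using that xs ys by (intro eq) auto
  then have "xs = ys"
    using xs ys assms(3) fin by (intro comparable_blocks) (auto simp: list_all2_conv_all_nth)
  then show ?thesis by (simp add: xs ys)
qed

lemma block_union_finite:
  "block_union A p s \<Longrightarrow> (\<And>a. A a \<Longrightarrow> finite a) \<Longrightarrow> finite s"
  by (auto simp: block_union_def)

lemma in_schreier_finite: "in_schreier lam x s \<Longrightarrow> finite s"
proof (induction rule: in_schreier.induct)
  case (sum x a cs ss)
  have "finite t" if t: "t \<in> set ss" for t
  proof -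
    obtain i where i: "i < length cs" "t = ss ! i"
      using t sum.hyps(10) unfolding in_set_conv_nth by force
    show ?thesis using block_union_finite[OF sum.IH[rule_format, OF i(1)]] i(2) by blast
  qed
  then show ?case by blast
qed auto

lemma in_schreier_nonempty: "in_schreier lam x s \<Longrightarrow> x \<noteq> 0 \<Longrightarrow> s \<noteq> {}"
proof (induction rule: in_schreier.induct)
  case (exp_succ ts b)
  then have "hd ts \<noteq> {}" using omega_exp_pos[of b] by auto
  then show ?case using hd_in_set[OF exp_succ.hyps(1)] by blast
next
  case (sum x a cs ss)
  have "0 < length cs" using sum.hyps by simp
  then obtain ts where ts: "length ts = snd (cs ! 0)" "\<forall>t\<in>set ts. t \<noteq> {}" "ss ! 0 = \<Union>(set ts)"
    using sum.IH omega_exp_pos[of "fst (cs ! 0)"] unfolding block_union_def by (metis less_irrefl)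
  have "1 \<le> snd (cs ! 0)" using sum.hyps \<open>0 < length cs\<close> by (metis (no_types, lifting) case_prod_beta nth_mem)
  then have "hd ts \<in> set ts" using ts(1) by (cases ts) auto
  then have "ss ! 0 \<noteq> {}" using ts(2,3) by blast
  then show ?case using \<open>0 < length cs\<close> sum.hyps by (metis Union_empty_conv nth_mem)
qed auto

section \<open>Inversion of the Schreier rules\<close>

lemma omega_exp_neq_osuc:
  assumes "z \<noteq> 0"
  shows "omega_exp b \<noteq> osuc z"
proof
  assume eq: "omega_exp b = osuc z"
  then have "b = 0" using is_limit_omega_exp not_is_limit_osuc by metis
  then show False using eq assms by (simp add: oexp_rec one_cord_def osuc_inject)
qed

text \<open>The ordinal alone decides which rule came last: a successor above 1 is neither a limit
  nor a power of \<omega>. The following inversions likewise rest on strict monotonicity of powers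
  in the exponent.\<close>

lemma in_schreier_succE:
  assumes "in_schreier lam (osuc z) t" "z \<noteq> 0"
  obtains n s where "t = insert n s" "in_schreier lam z s" "set_less {n} s"
  using assms(1)
proof cases
  case (sum a cs ss)
  then show thesis using not_is_limit_osuc by blast
qed (use assms that omega_exp_neq_osuc osuc_neq_0 in \<open>auto simp: one_cord_def osuc_inject\<close>, metis+)

lemma in_schreier_exp_succE:
  assumes "in_schreier lam (omega_exp (osuc b)) t"
  obtains ts where "ts \<noteq> []" "length ts = Min (hd ts)" "sorted_wrt set_less ts"
    "\<forall>t\<in>set ts. in_schreier lam (omega_exp b) t" "t = \<Union>(set ts)"
  using assms
proof cases
  case zero
  then show thesis using omega_exp_pos[of "osuc b"] by simp
next
  case (one n)
  then show thesis using omega_exp_eq_iff[of "osuc b" 0] osuc_neq_0 by (simp add: oexp_rec)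
next
  case (succ z n s)
  then show thesis using omega_exp_neq_osuc by blast
next
  case (exp_succ ts c)
  then show thesis using that by (simp add: omega_exp_eq_iff osuc_inject)
next
  case (exp_limit l)
  then show thesis using not_is_limit_osuc[of b] by (simp add: omega_exp_eq_iff)
next
  case (sum a cs ss)
  have "a < osuc b" "osuc b < osuc a" using sum(4,5) by (simp_all only: omega_exp_less_iff)
  then show thesis by (simp add: less_osuc_iff osuc_le_iff)
qed

lemma in_schreier_exp_limitE:
  assumes "in_schreier lam (omega_exp l) t" "is_limit l"
  shows "in_schreier lam (omega_exp (lam l (Min t))) t"
  using assms(1)
proof cases
  case zero
  then show ?thesis using omega_exp_pos[of l] by simp
next
  case (one n)
  then show ?thesis using omega_exp_eq_iff[of l 0] assms(2) by (simp add: oexp_rec is_limit_def)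
next
  case (succ z n s)
  then show ?thesis using omega_exp_neq_osuc by blast
next
  case (exp_succ ts c)
  then show ?thesis using not_is_limit_osuc[of c] assms(2) by (simp add: omega_exp_eq_iff)
next
  case (exp_limit l')
  then show ?thesis by (simp add: omega_exp_eq_iff)
next
  case (sum a cs ss)
  have "a < l" "l < osuc a" using sum(4,5) by (simp_all only: omega_exp_less_iff)
  then show ?thesis by (simp add: less_osuc_iff)
qed

lemma in_schreier_sumE:
  assumes "in_schreier lam x t" "is_limit x" "omega_exp a < x" "x < omega_exp (osuc a)"
  obtains cs ss where "sorted_wrt (\<lambda>c d. fst c > fst d) cs" "\<forall>c\<in>set cs. 1 \<le> snd c"
    "x = omega_sum cs" "length ss = length cs" "sorted_wrt (\<lambda>s t. set_less t s) ss"
    "\<forall>i<length cs. block_union (in_schreier lam (omega_exp (fst (cs ! i)))) (snd (cs ! i)) (ss ! i)"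
    "t = \<Union>(set ss)"
proof -
  have not_exp: "x \<noteq> omega_exp b" for b
    using assms(3,4) by (auto simp: omega_exp_less_iff less_osuc_iff)
  show thesis
    using assms(1)
  proof cases
    case zero
    then show thesis using assms(2) by (simp add: is_limit_def)
  next
    case (one n)
    then show thesis using assms(2) not_is_limit_osuc by (simp add: one_cord_def)
  next
    case (succ z n s)
    then show thesis using assms(2) not_is_limit_osuc by simp
  next
    case (sum b cs ss)
    show thesis
      by (rule that[OF sum(8) _ sum(10-13) sum(1)]) (use sum(9) in auto)
  qed (use not_exp in blast)+
qed

text \<open>The ordinal fixes the last rule and, by uniqueness of normal forms, its parameters. The
  remaining data, namely the number of blocks at \<omega>^(b + 1) and the member of the fundamental
  sequence at \<omega>^l, depend only on the minimum, which comparable nonempty finite sets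
  share.\<close>

theorem in_schreier_thin:
  "in_schreier lam x s \<Longrightarrow> in_schreier lam x t \<Longrightarrow> comparable s t \<Longrightarrow> s = t"
proof (induction arbitrary: t rule: in_schreier.induct)
  case zero
  have "t = {}" using zero(1)
  proof cases
    case one
    then show ?thesis using osuc_neq_0[of 0] by (simp add: one_cord_def)
  next
    case (succ z)
    then show ?thesis using osuc_neq_0[of z] by simp
  next
    case (exp_succ ts b)
    then show ?thesis using omega_exp_pos[of "osuc b"] by simp
  next
    case (exp_limit l)
    then show ?thesis using omega_exp_pos[of l] by simp
  next
    case sum
    then show ?thesis by (simp add: is_limit_def)
  qed simp
  then show ?case by simp
next
  case (one n)
  have "t \<noteq> {}" "finite t"
    using in_schreier_nonempty[OF one(2)] in_schreier_finite[OF one(2)] osuc_neq_0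
    by (auto simp: one_cord_def)
  show ?case using one(2)
  proof cases
    case (one m)
    then show ?thesis using \<open>comparable {n} t\<close> by (auto simp: comparable_def initial_def)
  next
    case zero
    then show ?thesis using osuc_neq_0[of 0] by (simp add: one_cord_def)
  next
    case (succ z)
    then show ?thesis by (simp add: one_cord_def osuc_inject)
  next
    case (exp_succ ts b)
    then show ?thesis using omega_exp_eq_iff[of "osuc b" 0] osuc_neq_0 by (simp add: oexp_rec)
  next
    case (exp_limit l)
    then show ?thesis using omega_exp_eq_iff[of l 0] by (simp add: oexp_rec is_limit_def)
  next
    case sum
    then show ?thesis using not_is_limit_osuc by (simp add: one_cord_def)
  qed
next
  case (succ z n s)
  obtain m t' where t: "t = insert m t'" "in_schreier lam z t'" "set_less {m} t'"
    using in_schreier_succE[OF succ.prems(1) succ.hyps(1)] by metis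
  have fin: "finite s" "finite t'" using in_schreier_finite succ.hyps t by auto
  have less: "n < i" if "i \<in> s" for i using set_lessD[OF succ.hyps(4) _ fin(1) _ that] by simp
  have less': "m < i" if "i \<in> t'" for i using set_lessD[OF t(3) _ fin(2) _ that] by simp
  have "Min (insert n s) = n" "Min (insert m t') = m"
    using fin less less' by (auto intro: Min_insert2 less_imp_le)
  then have "n = m" using comparable_Min[OF succ.prems(2)] fin t(1) by simp
  moreover have "n \<notin> s" "n \<notin> t'" using less less' \<open>n = m\<close> by auto
  then have "comparable s t'"
    using succ.prems(2) unfolding t(1) \<open>n = m\<close>[symmetric] comparable_def initial_def by blast
  then have "s = t'" using succ.IH t(2) by simp
  ultimately show ?case by (simp add: t(1))
next
  case (exp_succ ts b)
  obtain us where us: "us \<noteq> []" "length us = Min (hd us)" "sorted_wrt set_less us"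
    "\<forall>t\<in>set us. in_schreier lam (omega_exp b) t" "t = \<Union>(set us)"
    using in_schreier_exp_succE[OF exp_succ.prems(1)] by metis
  have ne: "r \<noteq> {}" "finite r" if "r \<in> set ts \<union> set us" for r
    using exp_succ.IH us(4) that in_schreier_nonempty in_schreier_finite omega_exp_pos[of b]
    by (metis Un_iff less_irrefl)+
  \<comment> \<open>The number of blocks is the minimum of the first block. Being also the minimum
    of the union, it is the same for \<open>ts\<close> and \<open>us\<close>.\<close>
  have Min_hd: "Min (\<Union>(set rs)) = Min (hd rs)"
    if rs: "rs \<noteq> []" "sorted_wrt set_less rs" "\<forall>r\<in>set rs. r \<noteq> {} \<and> finite r" for rs
  proof (rule Min_eqI)
    show "finite (\<Union>(set rs))" using rs by auto
    have hd: "hd rs \<in> set rs" using rs(1) by simp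
    then show "Min (hd rs) \<in> \<Union>(set rs)" using rs(3) Min_in by blast
    fix i assume "i \<in> \<Union>(set rs)"
    then obtain r where r: "r \<in> set rs" "i \<in> r" by blast
    show "Min (hd rs) \<le> i"
    proof (cases "r = hd rs")
      case False
      then have "set_less (hd rs) r" using rs(1,2) r(1) by (cases rs) auto
      moreover have "Min (hd rs) \<in> hd rs" "finite (hd rs)" "finite r" using rs(3) hd r(1) by auto
      ultimately show ?thesis using set_lessD r(2) less_imp_le by blast
    qed (use r rs hd in auto)
  qed
  have "hd ts \<in> set ts" "hd us \<in> set us" using exp_succ.hyps(1) us(1) by simp_all
  then have "\<Union>(set ts) \<noteq> {}" "\<Union>(set us) \<noteq> {}" using ne(1) by (metis UnCI Union_empty_conv)+
  moreover have "finite (\<Union>(set ts))" "finite (\<Union>(set us))" using ne(2) by auto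
  ultimately have "length ts = length us"
    using comparable_Min[OF exp_succ.prems(2)] Min_hd[OF exp_succ.hyps(1,3)] Min_hd[OF us(1,3)] ne
      us(2,5) exp_succ.hyps(2) by auto
  then have "ts = us"
    using exp_succ.hyps(3) us(3-5) ne exp_succ.prems(2) exp_succ.IH
    by (intro comparable_blocks) (auto simp: list_all2_conv_all_nth)
  then show ?case by (simp add: us(5))
next
  case (exp_limit l s)
  have l0: "omega_exp l \<noteq> 0" using omega_exp_pos[of l] by simp
  have "Min s = Min t"
    using comparable_Min[OF exp_limit.prems(2)] exp_limit.hyps in_schreier_finite
      in_schreier_nonempty[OF exp_limit.prems(1) l0] exp_limit.prems(1) by metis
  then show ?case
    using exp_limit.IH in_schreier_exp_limitE[OF exp_limit.prems(1) exp_limit.hyps(1)]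
      exp_limit.prems(2) by simp
next
  case (sum x a cs ss)
  obtain ds us where ds: "sorted_wrt (\<lambda>c d. fst c > fst d) ds" "\<forall>c\<in>set ds. 1 \<le> snd c"
    "x = omega_sum ds" and us: "length us = length ds" "sorted_wrt (\<lambda>s t. set_less t s) us"
    "\<forall>i<length ds. block_union (in_schreier lam (omega_exp (fst (ds ! i)))) (snd (ds ! i)) (us ! i)"
    "t = \<Union>(set us)"
    using in_schreier_sumE[OF sum.prems(1) sum.hyps(1,3,4)] by metis
  have "\<forall>c\<in>set cs. 1 \<le> snd c" using sum.hyps(8) by auto
  \<comment> \<open>Equal normal forms give both sets the same number of pieces, and corresponding
    pieces the same number of blocks.\<close>
  then have "cs = ds" using omega_sum_inject[OF sum.hyps(7) _ ds(1,2)] sum.hyps(9) ds(3) by simp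
  note us = us[folded this]
  have eq: "ss ! i = us ! i" if "i < length cs" "comparable (ss ! i) (us ! i)" for i
    by (rule block_union_comparable[OF sum.IH[rule_format, OF that(1)] us(3)[rule_format, OF that(1)] that(2)])
      (use in_schreier_finite in blast)+
  have fin: "finite r" if r: "r \<in> set ss \<union> set us" for r
  proof -
    obtain i where i: "i < length cs" "r = ss ! i \<or> r = us ! i"
      using r us(1) sum.hyps(10) unfolding Un_iff in_set_conv_nth by metis
    have "finite (ss ! i)" "finite (us ! i)"
      using block_union_finite[OF sum.IH[rule_format, OF i(1)]]
        block_union_finite[OF us(3)[rule_format, OF i(1)]] in_schreier_finite by blast+
    then show ?thesis using i(2) by blast
  qed
  \<comment> \<open>The pieces are listed in decreasing order, whereas
    \<open>comparable_blocks\<close> expects increasing lists.\<close>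
  have "rev ss = rev us"
  proof (rule comparable_blocks)
    show "list_all2 (\<lambda>s t. comparable s t \<longrightarrow> s = t) (rev ss) (rev us)"
      using eq us(1) sum.hyps(10) by (simp add: list_all2_rev) (simp add: list_all2_conv_all_nth)
  qed (use us sum.hyps(11) sum.prems(2) fin in \<open>auto simp: sorted_wrt_rev\<close>)
  then show ?case by (simp add: us(4))
qed

section \<open>From thin families of sets to the theorem\<close>

lemma (in located_words) schreier_seqs_thin:
  assumes t: "t \<in> seqs" and "x \<noteq> 0"
    and "map t [1..<Suc l] \<in> schreier_seqs lam x \<alpha> v k" "map t [1..<Suc m] \<in> schreier_seqs lam x \<alpha> v k"
  shows "l = m"
proof -
  let ?g = "\<lambda>n. Min (dom (t n))"
  have g_less: "?g i < ?g j" if "1 \<le> i" "i < j" for i j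
  proof -
    have "t i \<in> words" "t j \<in> words" using that t by (auto intro: seqsD)
    then have "?g i \<in> dom (t i)" "?g j \<in> dom (t j)" using wordsD(1,2) by (auto intro!: Min_in)
    then show ?thesis using seqs_before[OF t that] by (auto simp: before_def)
  qed
  have "set (map t [1..<Suc n]) = t ` {1..n}" for n by (simp add: atLeastLessThanSuc_atLeastAtMost del: upt_Suc)
  then have "in_schreier lam x (?g ` {1..l})" "in_schreier lam x (?g ` {1..m})"
    using assms(2-4) by (simp_all only: schreier_seqs_def schreier_def image_image if_False mem_Collect_eq)
  moreover have "initial (?g ` {1..i}) (?g ` {1..j})" if "i \<le> j" for i j
    unfolding initial_def
  proof (intro conjI ballI impI)
    fix a b assume "a \<in> ?g ` {1..i}" "b \<in> ?g ` {1..j}" "b < a"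
    then obtain n n' where "a = ?g n" "b = ?g n'" "n \<le> i" "1 \<le> n" "1 \<le> n'" "?g n' < ?g n" by auto
    moreover from this have "n' < n" using g_less by (metis less_asym linorder_neqE_nat)
    ultimately show "b \<in> ?g ` {1..i}" by auto
  qed (use that in auto)
  then have "comparable (?g ` {1..l}) (?g ` {1..m})"
    unfolding comparable_def by (meson nat_le_linear)
  ultimately have "?g ` {1..l} = ?g ` {1..m}" by (rule in_schreier_thin)
  \<comment> \<open>Distinct terms have distinct minima, so the set of minima determines the length
    of the segment.\<close>
  moreover have "inj_on ?g {1..n}" for n
  proof (rule inj_onI)
    fix i j assume "i \<in> {1..n}" "j \<in> {1..n}" "?g i = ?g j"
    then show "i = j" using g_less[of i j] g_less[of j i] by (cases i j rule: linorder_cases) auto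
  qed
  then have "card (?g ` {1..n}) = n" for n by (simp add: card_image)
  ultimately show ?thesis by metis
qed

theorem theorem2p5:
  fixes lam :: "cord \<Rightarrow> nat \<Rightarrow> cord"
    and \<xi> :: cord
    and \<alpha> :: "nat \<Rightarrow> 'a"
    and v :: 'a
    and k :: "nat \<Rightarrow> nat"
    and F :: "'a word list set"
    and w :: "nat \<Rightarrow> 'a word"
  assumes "fundamental_system lam"
    and "1 \<le> \<xi>"
    and "inj_on \<alpha> {1..}"
    and "v \<notin> \<alpha> ` {1..}"
    and "\<forall>n\<ge>1. 1 \<le> k n"
    and "mono_on {1..} k"
    and "F \<subseteq> fin_seqs \<alpha> v k"
    and "w \<in> var_seqs \<alpha> v k"
  shows "\<exists>u. extraction \<alpha> v k u w \<and>
    (schreier_seqs lam \<xi> \<alpha> v k \<inter> EV_fin \<alpha> v k u \<subseteq> F \<or>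
     schreier_seqs lam \<xi> \<alpha> v k \<inter> EV_fin \<alpha> v k u \<subseteq> fin_seqs \<alpha> v k - F)"
proof -
  interpret located_words \<alpha> v k
    using assms(4-6) by unfold_locales auto
  let ?S = "schreier_seqs lam \<xi> \<alpha> v k"
  have \<xi>: "\<xi> \<noteq> 0" using assms(2) less_osuc[of 0] by (auto simp: one_cord_def)
  obtain u where u: "ext u w" and or: "evf u \<inter> (F \<inter> ?S) = {} \<or>
      (\<forall>t\<in>seqs. (\<forall>n\<ge>1. t n \<in> ev u) \<longrightarrow> (\<exists>m. map t [1..<Suc m] \<in> F \<inter> ?S))"
    by (rule nash_williams[OF assms(8)])
  note u_seqs = ext_seqs[OF u]
  from or show ?thesis
  proof
    assume "evf u \<inter> (F \<inter> ?S) = {}"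
    then have "?S \<inter> evf u \<subseteq> fin_seqs \<alpha> v k - F" by (auto simp: EV_fin_def)
    with u show ?thesis by blast
  next
    assume hit: "\<forall>t\<in>seqs. (\<forall>n\<ge>1. t n \<in> ev u) \<longrightarrow> (\<exists>m. map t [1..<Suc m] \<in> F \<inter> ?S)"
    have "s \<in> F" if s: "s \<in> ?S" "s \<in> evf u" for s
    proof -
      have s_ev: "set s \<subseteq> ev u" "sorted_wrt before s" using s(2) evf_iff[OF u_seqs] by auto
      then have "set s \<subseteq> words" using ev_words[OF u_seqs] by blast
      then obtain c where c: "\<And>n. 1 \<le> n \<Longrightarrow> u (n + c) \<in> after s u"
        using shift_after[OF u_seqs] by metis
      \<comment> \<open>\<open>s\<close> continued by terms of \<open>u\<close> that lie beyond it.
        Lists are indexed from 0 and sequences from 1, hence \<open>n - 1\<close>.\<close>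
      define t where "t n = (if n \<le> length s then s ! (n - 1) else u (n - length s + c))" for n
      have t_ev: "t n \<in> ev u" if "1 \<le> n" for n
        using that s_ev(1) nth_in_ev[of "n - length s + c" u] by (auto simp: t_def)
      have t: "t \<in> seqs"
      proof (rule seqsI)
        fix n :: nat assume n: "1 \<le> n"
        show "t n \<in> words" using t_ev[OF n] ev_words[OF u_seqs] by blast
        consider "Suc n \<le> length s" | "n = length s" | "length s < n" by linarith
        then show "before (t n) (t (Suc n))"
        proof cases
          case 1
          then show ?thesis using n sorted_wrt_nth_less[OF s_ev(2), of "n - 1" n] by (simp add: t_def)
        next
          case 2
          then have "s ! (n - 1) \<in> set s" using n by simp
          then show ?thesis using c[of 1] 2 by (simp add: t_def after_def)
        next
          case 3
          then show ?thesis
            using seqs_before[OF u_seqs, of "n - length s + c" "Suc n - length s + c"]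
            by (simp add: t_def)
        qed
      qed
      have s_eq: "s = map t [1..<Suc (length s)]"
        by (rule nth_equalityI) (simp_all add: t_def del: upt_Suc)
      obtain m where m: "map t [1..<Suc m] \<in> F \<inter> ?S" using hit t t_ev by blast
      then have "length s = m"
        using schreier_seqs_thin[OF t \<xi>, of "length s" lam m] s(1) s_eq by simp
      with m s_eq show "s \<in> F" by simp
    qed
    with u show ?thesis by blast
  qed
qed

end
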